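(* Let $n\ge 1$ be an integer and let $\Lambda$ be a subset of $\Lambda_1(n)$ with $\Lambda_0(n)\subset\Lambda$. Let $L,H$ be closed subgroups of $\mathrm{B}(n)$. Assume that for each $R\ge 0$ the intersection $\mu_\Lambda(L)\cap \bar B_R[\mu_\Lambda(H)]$ is bounded in $\mathbb{R}^{\Lambda}$. Then the natural $L$-action on $\mathrm{B}(n)/H$, $(\ell,gH)\mapsto \ell gH$, is proper.
   Context: $[n]:=\{1,\dots,n\}$. $\mathrm{B}(n)$ is the topological group of invertible real upper triangular $n\times n$ matrices, i.e. $X\in\mathrm{GL}(n,\mathbb{R})$ with $x_{ij}=0$ for $i>j$. For a real square matrix $X=(x_{ij})$, $\|X\|:=\max_{i,j}|x_{ij}|$. For $1\le i\le j\le n$, $\Phi_{ij}:\mathrm{B}(n)\to\mathrm{B}(j-i+1)$ sends $X=(x_{st})_{1\le s,t\le n}$ to its submatrix $(x_{st})_{i\le s,t\le j}$. For $m\ge1$ and $1\le q\le m$, $\bigwedge^q:\mathrm{GL}(m,\mathbb{R})\to\mathrm{GL}(N,\mathbb{R})$, $N=\binom{m}{q}$, is the $q$-th exterior power representation (compound matrix): rows and columns are indexed by $q$-element subsets $I,J$ of $[m]$ in lexicographic order, and the $(I,J)$-entry of $\bigwedge^qA$ is the minor $\det(A_{IJ})$. $\Lambda_0(n):=\{(i,j,q,\varepsilon)\in[n]^3\times\{\pm1\} : q=1,\ \varepsilon=1,\ \text{and } (i=j \text{ or } (i,j)=(1,n))\}$. $\Lambda_1(n):=\{(i,j,q,\varepsilon)\in[n]^3\times\{\pm1\}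 : i\le j,\ 1\le q\le j-i+1\}$. For nonempty $\Lambda\subset\Lambda_1(n)$, $\mu_\Lambda:\mathrm{B}(n)\to\mathbb{R}^\Lambda$ is $\mu_\Lambda(X):=\bigl(\log\|\bigwedge^q\Phi_{ij}(X^\varepsilon)\|\bigr)_{(i,j,q,\varepsilon)\in\Lambda}$. $\mathbb{R}^\Lambda$ carries the Euclidean metric $d$ (any norm metric gives an equivalent hypothesis), and for $A\subset\mathbb{R}^\Lambda$, $\bar B_R[A]:=\{y : d(y,a)\le R \text{ for some } a\in A\}$ is the closed $R$-neighborhood of $A$. A continuous action of a locally compact Hausdorff group $L$ on a locally compact Hausdorff space $S$ is proper if the map $L\times S\to S\times S$, $(g,x)\mapsto(x,gx)$, is such that preimages of compact sets are compact. *)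

theory Defs
  imports
    "HOL-Algebra.Left_Coset"
    "HOL-Analysis.Abstract_Metric_Spaces"
    "HOL-Analysis.Function_Topology"
    "HOL-Analysis.Product_Topology"
    "HOL-Analysis.L2_Norm"
    "Jordan_Normal_Form.Determinant"
    "Jordan_Normal_Form.DL_Submatrix"
begin

section \<open>The topological group of invertible upper triangular matrices\<close>

definition B_group :: "nat \<Rightarrow> real mat monoid" where
  "B_group n = \<lparr>carrier = {X \<in> carrier_mat n n. upper_triangular X \<and> invertible_mat X},
                monoid.mult = (*), one = 1\<^sub>m n\<rparr>"

text \<open>The topology of \<open>GL(n, \<real>)\<close> as a subspace of the space of all real \<open>n \<times> n\<close> matrices, that is,
  the initial topology with respect to the matrix entries.\<close>
definition B_topology :: "nat \<Rightarrow> real mat topology" where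
  "B_topology n =
     pullback_topology (carrier (B_group n))
       (\<lambda>X. \<lambda>p \<in> {..<n} \<times> {..<n}. X $$ p)
       (product_topology (\<lambda>_. euclideanreal) ({..<n} \<times> {..<n}))"

lemma topspace_B_topology: "topspace (B_topology n) = carrier (B_group n)"
  by (auto simp: B_topology_def topspace_pullback_topology)

section \<open>Submatrices, compound matrices and the maximum norm\<close>

definition max_norm :: "real mat \<Rightarrow> real" where
  "max_norm X = Max (abs ` elements_mat X)"

text \<open>Matrix rows and columns are numbered from 0, whereas \<open>i\<close> and \<open>j\<close> are numbered from 1.\<close>
definition Phi :: "nat \<Rightarrow> nat \<Rightarrow> real mat \<Rightarrow> real mat" where
  "Phi i j X = mat (j - i + 1) (j - i + 1) (\<lambda>(s, t). X $$ (i - 1 + s, i - 1 + t))"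

text \<open>The \<open>q\<close>-element subsets of \<open>{..<m}\<close>, each as an increasing list, in lexicographic order;
  see \<open>sorted_wrt_q_subsets\<close> and \<open>set_q_subsets\<close>.\<close>
definition q_subsets :: "nat \<Rightarrow> nat \<Rightarrow> nat list list" where
  "q_subsets m q = filter (\<lambda>I. length I = q) (subseqs [0..<m])"

definition compound_mat :: "nat \<Rightarrow> real mat \<Rightarrow> real mat" where
  "compound_mat q A =
     (let S = q_subsets (dim_row A) q; N = length S
      in mat N N (\<lambda>(a, b). det (submatrix A (set (S ! a)) (set (S ! b)))))"

section \<open>The map \<open>\<mu>\<close>\<close>

definition Lambda0 :: "nat \<Rightarrow> (nat \<times> nat \<times> nat \<times> int) set" where
  "Lambda0 n = {(i, j, q, \<epsilon>). i \<in> {1..n} \<and> j \<in> {1..n} \<and> q \<in> {1..n} \<and> \<epsilon> \<in> {1, -1} \<and>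
                 q = 1 \<and> \<epsilon> = 1 \<and> (i = j \<or> (i, j) = (1, n))}"

definition Lambda1 :: "nat \<Rightarrow> (nat \<times> nat \<times> nat \<times> int) set" where
  "Lambda1 n = {(i, j, q, \<epsilon>). i \<in> {1..n} \<and> j \<in> {1..n} \<and> q \<in> {1..n} \<and> \<epsilon> \<in> {1, -1} \<and>
                 i \<le> j \<and> 1 \<le> q \<and> q \<le> j - i + 1}"

text \<open>\<open>\<real>\<^sup>\<Lambda>\<close> is represented by \<open>extensional \<Lambda>\<close>.\<close>
definition mu :: "nat \<Rightarrow> (nat \<times> nat \<times> nat \<times> int) set \<Rightarrow> real mat \<Rightarrow> nat \<times> nat \<times> nat \<times> int \<Rightarrow> real" where
  "mu n \<Lambda> X =
     (\<lambda>(i, j, q, \<epsilon>) \<in> \<Lambda>. ln (max_norm (compound_mat q (Phi i j (X [^]\<^bsub>B_group n\<^esub> \<epsilon>)))))"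

definition euclid_dist :: "'i set \<Rightarrow> ('i \<Rightarrow> real) \<Rightarrow> ('i \<Rightarrow> real) \<Rightarrow> real" where
  "euclid_dist \<Lambda> x y = L2_set (\<lambda>l. x l - y l) \<Lambda>"

definition euclid_bounded :: "'i set \<Rightarrow> ('i \<Rightarrow> real) set \<Rightarrow> bool" where
  "euclid_bounded \<Lambda> A \<longleftrightarrow> Metric_space.mbounded (extensional \<Lambda>) (euclid_dist \<Lambda>) A"

definition closed_nbhd :: "'i set \<Rightarrow> real \<Rightarrow> ('i \<Rightarrow> real) set \<Rightarrow> ('i \<Rightarrow> real) set" where
  "closed_nbhd \<Lambda> R A = {y \<in> extensional \<Lambda>. \<exists>a\<in>A. euclid_dist \<Lambda> y a \<le> R}"

section \<open>Quotient topology and proper actions\<close>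

definition quotient_topology :: "'a topology \<Rightarrow> ('a \<Rightarrow> 'b) \<Rightarrow> 'b topology" where
  "quotient_topology X p =
     topology (\<lambda>U. U \<subseteq> p ` topspace X \<and> openin X {x \<in> topspace X. p x \<in> U})"

definition coset_topology :: "nat \<Rightarrow> real mat set \<Rightarrow> real mat set topology" where
  "coset_topology n H = quotient_topology (B_topology n) (\<lambda>g. l_coset (B_group n) g H)"

text \<open>Properness of a continuous action \<open>act\<close> of a locally compact Hausdorff group with topology
  \<open>T\<close> on a locally compact Hausdorff space \<open>S\<close>.\<close>
definition proper_action :: "'g topology \<Rightarrow> 's topology \<Rightarrow> ('g \<Rightarrow> 's \<Rightarrow> 's) \<Rightarrow> bool" where
  "proper_action T S act \<longleftrightarrow>
     (\<forall>K. compactin (prod_topology S S) K \<longrightarrow>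
          compactin (prod_topology T S)
            {(g, x). g \<in> topspace T \<and> x \<in> topspace S \<and> (x, act g x) \<in> K})"

section \<open>Basic facts\<close>

lemma quotient_map_quotient_topology: "quotient_map X (quotient_topology X p) p"
proof -
  have "istopology (\<lambda>U. U \<subseteq> p ` topspace X \<and> openin X {x \<in> topspace X. p x \<in> U})"
    unfolding istopology_def
  proof (intro conjI allI impI)
    fix U V
    assume "U \<subseteq> p ` topspace X \<and> openin X {x \<in> topspace X. p x \<in> U}"
      and "V \<subseteq> p ` topspace X \<and> openin X {x \<in> topspace X. p x \<in> V}"
    moreover have "{x \<in> topspace X. p x \<in> U \<inter> V} =
        {x \<in> topspace X. p x \<in> U} \<inter> {x \<in> topspace X. p x \<in> V}" by auto
    ultimately show "U \<inter> V \<subseteq> p ` topspace X" "openin X {x \<in> topspace X. p x \<in> U \<inter> V}"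
      by auto
  next
    fix \<U> assume *: "\<forall>U\<in>\<U>. U \<subseteq> p ` topspace X \<and> openin X {x \<in> topspace X. p x \<in> U}"
    then show "\<Union>\<U> \<subseteq> p ` topspace X" by auto
    have "{x \<in> topspace X. p x \<in> \<Union>\<U>} = (\<Union>U\<in>\<U>. {x \<in> topspace X. p x \<in> U})" by auto
    then show "openin X {x \<in> topspace X. p x \<in> \<Union>\<U>}" using * by auto
  qed
  then have op: "openin (quotient_topology X p) U \<longleftrightarrow>
      U \<subseteq> p ` topspace X \<and> openin X {x \<in> topspace X. p x \<in> U}" for U
    by (simp add: quotient_topology_def)
  moreover have "{x \<in> topspace X. p x \<in> p ` topspace X} = topspace X" by auto
  ultimately have "topspace (quotient_topology X p) = p ` topspace X"
    by (metis openin_subset openin_topspace subset_antisym order_refl)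
  then show ?thesis using op by (auto simp: quotient_map_def)
qed

lemma topspace_coset_topology: "topspace (coset_topology n H) = lcosets\<^bsub>B_group n\<^esub> H"
  using quotient_imp_surjective_map[OF quotient_map_quotient_topology
      [of "B_topology n" "\<lambda>g. l_coset (B_group n) g H"]]
  unfolding coset_topology_def LCOSETS_def topspace_B_topology by blast

lemma Metric_space_euclid:
  assumes "finite \<Lambda>"
  shows "Metric_space (extensional \<Lambda>) (euclid_dist \<Lambda>)"
proof
  fix x y z :: "'a \<Rightarrow> real"
  show "0 \<le> euclid_dist \<Lambda> x y" by (simp add: euclid_dist_def)
  show "euclid_dist \<Lambda> x y = euclid_dist \<Lambda> y x"
    by (simp add: euclid_dist_def L2_set_def power2_commute)
  show "(euclid_dist \<Lambda> x y = 0) = (x = y)" if "x \<in> extensional \<Lambda>" "y \<in> extensional \<Lambda>"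
    using assms that by (auto simp: euclid_dist_def L2_set_eq_0_iff intro: extensionalityI)
  show "euclid_dist \<Lambda> x z \<le> euclid_dist \<Lambda> x y + euclid_dist \<Lambda> y z"
    using L2_set_triangle_ineq[of "\<lambda>l. x l - y l" "\<lambda>l. y l - z l" \<Lambda>] by (simp add: euclid_dist_def)
qed

lemma finite_Lambda1: "finite (Lambda1 n)"
  by (rule finite_subset[of _ "{1..n} \<times> {1..n} \<times> {1..n} \<times> {1, -1}"]) (auto simp: Lambda1_def)

lemma set_q_subsets: "set ` set (q_subsets m q) = {I. I \<subseteq> {..<m} \<and> card I = q}"
proof -
  have d: "distinct I" if "I \<in> set (subseqs [0..<m])" for I
    using that by (rule subseqs_distinctD) simp
  have "{I. I \<subseteq> {..<m}} = set ` set (subseqs [0..<m])"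
    using subseqs_powset[of "[0..<m]"] by (auto simp: lessThan_atLeast0)
  then have "{I. I \<subseteq> {..<m} \<and> card I = q} = {I \<in> set ` set (subseqs [0..<m]). card I = q}"
    by blast
  also have "\<dots> = set ` set (q_subsets m q)"
    using d by (auto simp: q_subsets_def distinct_card)
  finally show ?thesis by simp
qed

lemma length_q_subsets: "length (q_subsets m q) = m choose q"
proof -
  have "length (filter (\<lambda>I. length I = q) (subseqs xs)) = length xs choose q" for xs :: "nat list"
  proof (induction xs arbitrary: q)
    case Nil
    then show ?case by (cases q) auto
  next
    case (Cons x xs)
    show ?case
      using Cons[of 0] by (cases q) (auto simp: Let_def filter_map o_def Cons)
  qed
  then show ?thesis by (simp add: q_subsets_def)
qed

lemma sorted_wrt_q_subsets:
  "sorted_wrt (\<lambda>I J. (I, J) \<in> lexord {(a, b). a < b}) (q_subsets m q)"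
proof -
  let ?R = "\<lambda>I J. (I, J) \<in> lexord {(a :: nat, b). a < b}"
  have sub: "set I \<subseteq> set xs" if "I \<in> set (subseqs xs)" for I and xs :: "nat list"
    using that subseqs_powset[of xs] by blast
  have "sorted_wrt ?R (filter (\<lambda>I. length I = q) (subseqs xs))"
    if "sorted_wrt (<) xs" for xs :: "nat list"
    using that
  proof (induction xs arbitrary: q)
    case Nil
    then show ?case by simp
  next
    case (Cons x xs)
    have IH: "sorted_wrt ?R (filter (\<lambda>I. length I = q) (subseqs xs))" for q
      using Cons by simp
    have "filter (\<lambda>I. length I = q) (map ((#) x) (subseqs xs)) =
        (if q = 0 then [] else map ((#) x) (filter (\<lambda>I. length I = q - 1) (subseqs xs)))"
      by (cases q) (simp_all add: filter_map o_def)
    moreover have "sorted_wrt ?R (map ((#) x) (filter (\<lambda>I. length I = q - 1) (subseqs xs)))"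
      using IH[of "q - 1"] by (simp add: sorted_wrt_map)
    ultimately have 1: "sorted_wrt ?R (filter (\<lambda>I. length I = q) (map ((#) x) (subseqs xs)))"
      by (simp split: if_splits)
    have 2: "?R (x # I) J"
      if J: "J \<in> set (subseqs xs)" and l: "length J = Suc (length I)" for I J
    proof -
      obtain y J' where "J = y # J'" using l by (cases J) simp_all
      moreover have "y \<in> set xs" using sub[OF J] \<open>J = y # J'\<close> by simp
      then have "x < y" using Cons.prems by simp
      ultimately show ?thesis by simp
    qed
    have "sorted_wrt ?R (filter (\<lambda>I. length I = q) (map ((#) x) (subseqs xs)) @
        filter (\<lambda>I. length I = q) (subseqs xs))"
      unfolding sorted_wrt_append
    proof (intro conjI ballI 1 IH)
      fix I J
      assume I: "I \<in> set (filter (\<lambda>I. length I = q) (map ((#) x) (subseqs xs)))"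
        and J: "J \<in> set (filter (\<lambda>I. length I = q) (subseqs xs))"
      from I obtain I' where "I = x # I'" "length (x # I') = q" by auto
      with J 2[of J I'] show "?R I J" by simp
    qed
    then show ?case by (simp only: subseqs.simps Let_def filter_append)
  qed
  then show ?thesis by (simp add: q_subsets_def)
qed

end

theory Submission
  imports Defs
begin

text \<open>By Cauchy--Binet, multiplying \<open>X\<close> on both sides by elements of a fixed compact set changes every
  \<open>\<parallel>\<Lambda>\<^sup>q \<Phi>\<^sub>i\<^sub>j(X\<^sup>\<epsilon>)\<parallel>\<close> by at most a constant factor, so \<open>\<mu>\<close> moves by a bounded distance. Hence if
  \<open>g \<in> L\<close> lies in \<open>C H C\<^sup>-\<^sup>1\<close> with \<open>C\<close> compact, then \<open>\<mu>(g)\<close> lies in a bounded neighbourhood of \<open>\<mu>(H)\<close> and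
  therefore in a bounded set by hypothesis. The coordinates in \<open>\<Lambda>\<^sub>0\<close> control all entries of \<open>g\<close> from
  above and the diagonal entries from below, which confines \<open>g\<close> to a compact set. In a locally
  compact group this is properness of the action on the coset space.\<close>

no_notation subset_mset (infix "<#" 50)

section \<open>Topological groups acting on their coset spaces\<close>

text \<open>Cauchy--Binet enters as an inequality: expanding a minor of a product row by row gives
  terms that are each a bounded coefficient times 0 or plus or minus a minor of the other factor,
  and counting the terms gives the constant. This bounds norms in one direction; the opposite
  direction comes from multiplying back by the inverses, so a compact set is measured by a common
  entry bound for its elements and their inverses.

  Two features of triangular matrices shape the argument. \<open>Phi i j\<close> is multiplicative
  on them, unlike on general matrices. Their determinant is the product of the diagonal, so a lower
  bound on the diagonal keeps an entrywise bounded set away from the singular matrices.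

  On the topological side, the obstacle is to move between compact subsets of the quotient and of
  the group. The projection is open and the group locally compact, so every compact set of cosets is
  covered by the image of a compact set. Closedness of \<open>H\<close> makes the quotient
  Hausdorff, so compact sets of pairs are closed, and it remains to enclose a closed set in a
  compact one.\<close>

lemma openin_quotient_topology:
  "openin (quotient_topology X p) U \<longleftrightarrow> U \<subseteq> p ` topspace X \<and> openin X {x \<in> topspace X. p x \<in> U}"
proof -
  have q: "quotient_map X (quotient_topology X p) p"
    by (rule quotient_map_quotient_topology)
  have t: "topspace (quotient_topology X p) = p ` topspace X"
    using quotient_imp_surjective_map[OF q] by simp
  show ?thesis
    using q t unfolding quotient_map_def by (metis openin_subset)
qed

lemma topspace_quotient_topology: "topspace (quotient_topology X p) = p ` topspace X"
  using quotient_imp_surjective_map[OF quotient_map_quotient_topology] by metis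

lemma openin_prod_topologyE:
  assumes "openin (prod_topology X Y) W" "(x, y) \<in> W"
  obtains U V where "openin X U" "openin Y V" "x \<in> U" "y \<in> V" "U \<times> V \<subseteq> W"
  using assms unfolding openin_prod_topology_alt by meson

text \<open>Images of open sets that lie in compact sets form an open cover of \<open>K\<close>; the
  compact sets behind a finite subcover are united. The image of \<open>C\<close> may be larger than
  \<open>K\<close>, which is harmless for enclosing sets in compact ones.\<close>

lemma compact_lift_open_map:
  assumes p: "open_map X Y p" and surj: "p ` topspace X = topspace Y"
    and lc: "locally_compact_space X" and K: "compactin Y K"
  obtains C where "compactin X C" "K \<subseteq> p ` C"
proof -
  define \<U> where "\<U> = {U. openin X U \<and> (\<exists>C. compactin X C \<and> U \<subseteq> C)}"
  have "K \<subseteq> \<Union>((`) p ` \<U>)"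
  proof
    fix y assume "y \<in> K"
    then have "y \<in> p ` topspace X"
      using compactin_subset_topspace[OF K] surj by blast
    then obtain x where x: "x \<in> topspace X" "y = p x" by blast
    then obtain U where "U \<in> \<U>" "x \<in> U"
      using lc unfolding locally_compact_space_def \<U>_def by blast
    then show "y \<in> \<Union>((`) p ` \<U>)" using x by blast
  qed
  moreover have "\<forall>V\<in>(`) p ` \<U>. openin Y V"
    using p by (auto simp: open_map_def \<U>_def)
  ultimately obtain \<F> where \<F>: "finite \<F>" "\<F> \<subseteq> (`) p ` \<U>" "K \<subseteq> \<Union>\<F>"
    using K unfolding compactin_def by meson
  then obtain \<G> where \<G>: "finite \<G>" "\<G> \<subseteq> \<U>" "\<F> = (`) p ` \<G>"
    by (meson finite_subset_image)
  have "\<forall>U\<in>\<G>. \<exists>C. compactin X C \<and> U \<subseteq> C"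
    using \<G> by (auto simp: \<U>_def)
  then obtain c where c: "\<And>U. U \<in> \<G> \<Longrightarrow> compactin X (c U)" "\<And>U. U \<in> \<G> \<Longrightarrow> U \<subseteq> c U"
    by metis
  show thesis
  proof
    show "compactin X (\<Union>(c ` \<G>))"
      by (rule compactin_Union) (use c \<G> in auto)
    show "K \<subseteq> p ` \<Union>(c ` \<G>)"
      using \<F>(3) \<G>(3) c(2) by blast
  qed
qed

text \<open>The topology is an explicit \<open>T\<close> on the carrier rather than a type class
  instance, because the type of real matrices contains matrices of all sizes.\<close>

locale topological_group = group +
  fixes T :: "'a topology"
  assumes topspace_eq: "topspace T = carrier G"
    and continuous_mult: "continuous_map (prod_topology T T) T (\<lambda>(x, y). x \<otimes> y)"
    and continuous_inv: "continuous_map T T (\<lambda>x. inv x)"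
begin

lemma continuous_map_mult:
  assumes "continuous_map X T f" "continuous_map X T g"
  shows "continuous_map X T (\<lambda>x. f x \<otimes> g x)"
proof -
  have "continuous_map X (prod_topology T T) (\<lambda>x. (f x, g x))"
    using assms by (simp add: continuous_map_pairedI)
  from continuous_map_compose[OF this continuous_mult] show ?thesis
    by (simp add: o_def)
qed

lemma continuous_map_inv:
  assumes "continuous_map X T f"
  shows "continuous_map X T (\<lambda>x. inv (f x))"
  using continuous_map_compose[OF assms continuous_inv] by (simp add: o_def)

context
  fixes H assumes H: "subgroup H G"
begin

lemma l_coset_eq_iff:
  assumes "x \<in> carrier G" "y \<in> carrier G"
  shows "x <# H = y <# H \<longleftrightarrow> inv x \<otimes> y \<in> H"
proof
  assume "x <# H = y <# H"
  then have "y \<in> x <# H" using lcos_self[OF assms(2) H] by simp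
  then show "inv x \<otimes> y \<in> H"
    using subgroup.lcos_module_imp[OF H is_group assms(1)] by blast
next
  assume "inv x \<otimes> y \<in> H"
  then have "y \<in> x <# H"
    using subgroup.lcos_module_rev[OF H is_group] assms by blast
  then show "x <# H = y <# H"
    using l_repr_independence[OF _ assms(1) H] by blast
qed

abbreviation "proj \<equiv> \<lambda>g. g <# H"
abbreviation "Q \<equiv> quotient_topology T proj"

text \<open>The saturation of an open set is the union, over \<open>h\<close> in \<open>H\<close>,
  of its preimages under right multiplication by \<open>h\<close>, and these are open by
  continuity.\<close>

lemma open_map_l_coset: "open_map T Q proj"
  unfolding open_map_def
proof (intro allI impI)
  fix U assume U: "openin T U"
  then have UG: "U \<subseteq> carrier G"
    using openin_subset topspace_eq by blast
  have "{x \<in> topspace T. proj x \<in> proj ` U} = (\<Union>h\<in>H. {x \<in> topspace T. x \<otimes> h \<in> U})"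
  proof (intro equalityI subsetI)
    fix x assume "x \<in> {x \<in> topspace T. proj x \<in> proj ` U}"
    then obtain u where x: "x \<in> carrier G" and u: "u \<in> U" "proj x = proj u"
      using topspace_eq by blast
    then have "inv x \<otimes> u \<in> H" using l_coset_eq_iff UG by blast
    moreover have "x \<otimes> (inv x \<otimes> u) = u"
      using x u UG by (simp add: m_assoc[symmetric] subset_iff)
    ultimately show "x \<in> (\<Union>h\<in>H. {x \<in> topspace T. x \<otimes> h \<in> U})"
      using x u topspace_eq by (intro UN_I[of "inv x \<otimes> u"]) auto
  next
    fix x assume "x \<in> (\<Union>h\<in>H. {x \<in> topspace T. x \<otimes> h \<in> U})"
    then obtain h where h: "h \<in> H" "x \<in> carrier G" "x \<otimes> h \<in> U"
      using topspace_eq by blast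
    then have "h \<in> carrier G" using subgroup.mem_carrier[OF H] by blast
    then have "inv x \<otimes> (x \<otimes> h) = h" using h by (simp add: m_assoc[symmetric])
    then have "proj x = proj (x \<otimes> h)"
      using h UG by (subst l_coset_eq_iff) auto
    then show "x \<in> {x \<in> topspace T. proj x \<in> proj ` U}"
      using h topspace_eq by auto
  qed
  moreover have "openin T {x \<in> topspace T. x \<otimes> h \<in> U}" if "h \<in> H" for h
    using that topspace_eq subgroup.mem_carrier[OF H] U
    by (intro openin_continuous_map_preimage[OF continuous_map_mult]) auto
  ultimately have "openin T {x \<in> topspace T. proj x \<in> proj ` U}" by auto
  then show "openin Q (proj ` U)"
    unfolding openin_quotient_topology using UG topspace_eq by blast
qed

text \<open>Two elements have different cosets exactly on the set \<open>?W\<close>, which is open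
  because \<open>H\<close> is closed. An open rectangle inside \<open>?W\<close> projects to
  disjoint neighbourhoods, open because the projection is an open map.\<close>

lemma Hausdorff_coset_space:
  assumes "closedin T H"
  shows "Hausdorff_space Q"
  unfolding Hausdorff_space_def topspace_quotient_topology
proof (intro allI impI)
  fix A B assume "A \<in> proj ` topspace T \<and> B \<in> proj ` topspace T \<and> A \<noteq> B"
  then obtain x y where xy: "x \<in> carrier G" "y \<in> carrier G" "A = proj x" "B = proj y" "A \<noteq> B"
    using topspace_eq by auto
  let ?W = "{z \<in> topspace (prod_topology T T). inv (fst z) \<otimes> snd z \<in> topspace T - H}"
  have "openin (prod_topology T T) ?W"
    using assms
    by (intro openin_continuous_map_preimage[OF continuous_map_mult[OF continuous_map_inv]])
      (auto simp: continuous_map_fst continuous_map_snd)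
  moreover have "inv x \<otimes> y \<notin> H"
    using xy l_coset_eq_iff[of x y] by blast
  then have "(x, y) \<in> ?W"
    using xy(1,2) by (simp add: topspace_eq)
  ultimately obtain U V where UV: "openin T U" "openin T V" "x \<in> U" "y \<in> V" "U \<times> V \<subseteq> ?W"
    by (rule openin_prod_topologyE)
  have "disjnt (proj ` U) (proj ` V)"
    unfolding disjnt_iff
  proof (intro allI notI, elim conjE imageE)
    fix B u v assume uv: "B = proj u" "u \<in> U" "B = proj v" "v \<in> V"
    then have "(u, v) \<in> ?W" using UV(5) by blast
    then show False
      using uv l_coset_eq_iff[of u v] topspace_eq by auto
  qed
  then show "\<exists>U V. openin Q U \<and> openin Q V \<and> A \<in> U \<and> B \<in> V \<and> disjnt U V"
    using UV xy open_map_l_coset unfolding open_map_def by blast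
qed

text \<open>The product of a quotient map with an identity need not be a quotient map, so continuity
  does not descend formally from the group. Openness of the projection repairs this: a rectangle
  found upstairs projects to an open rectangle downstairs.\<close>

lemma continuous_map_action_coset:
  assumes "L \<subseteq> carrier G"
  shows "continuous_map (prod_topology (subtopology T L) Q) Q (\<lambda>(l, C). l <# C)"
    (is "continuous_map ?P Q ?f")
proof -
  have tP: "topspace ?P = L \<times> proj ` carrier G"
    using assms by (auto simp: topspace_quotient_topology topspace_eq)
  have act: "l <# proj x = proj (l \<otimes> x)" if "l \<in> carrier G" "x \<in> carrier G" for l x
    using that by (intro lcos_m_assoc subgroup.subset[OF H])
  have "openin ?P {z \<in> topspace ?P. ?f z \<in> W}" if W: "openin Q W" for W
    unfolding openin_prod_topology_alt
  proof (intro allI impI)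
    fix l C assume "(l, C) \<in> {z \<in> topspace ?P. ?f z \<in> W}"
    then have "l \<in> L" "C \<in> proj ` carrier G" "l <# C \<in> W"
      unfolding tP by simp_all
    then obtain x where x: "l \<in> L" "x \<in> carrier G" "C = proj x" "l <# C \<in> W"
      by blast
    have "openin T {x \<in> topspace T. proj x \<in> W}"
      using W[unfolded openin_quotient_topology] by simp
    from openin_continuous_map_preimage[OF continuous_mult this]
    have "openin (prod_topology T T)
        {z \<in> topspace (prod_topology T T). (\<lambda>(x, y). x \<otimes> y) z \<in> {x \<in> topspace T. proj x \<in> W}}"
      (is "openin _ ?Z") .
    moreover have "(l, x) \<in> ?Z"
      using x assms act[of l x] topspace_eq by auto
    ultimately obtain U V where UV: "openin T U" "openin T V" "l \<in> U" "x \<in> V" "U \<times> V \<subseteq> ?Z"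
      by (rule openin_prod_topologyE)
    have "(U \<inter> L) \<times> proj ` V \<subseteq> {z \<in> topspace ?P. ?f z \<in> W}"
    proof
      fix z assume "z \<in> (U \<inter> L) \<times> proj ` V"
      then obtain l' x' where z: "z = (l', proj x')" "l' \<in> U" "l' \<in> L" "x' \<in> V" by auto
      with UV(5) have "(l', x') \<in> ?Z" by blast
      then show "z \<in> {z \<in> topspace ?P. ?f z \<in> W}"
        using z act[of l' x'] unfolding tP by (auto simp: topspace_eq)
    qed
    moreover have "openin (subtopology T L) (U \<inter> L)"
      using UV by (auto simp: openin_subtopology)
    moreover have "openin Q (proj ` V)"
      using UV open_map_l_coset unfolding open_map_def by blast
    ultimately show "\<exists>U V. openin (subtopology T L) U \<and> openin Q V \<and> l \<in> U \<and> C \<in> V \<and>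
        U \<times> V \<subseteq> {z \<in> topspace ?P. ?f z \<in> W}"
      using UV x by blast
  qed
  moreover have "?f z \<in> topspace Q" if "z \<in> topspace ?P" for z
    using that assms act unfolding tP topspace_quotient_topology topspace_eq by fastforce
  ultimately show ?thesis
    unfolding continuous_map by blast
qed

text \<open>If the cosets of \<open>x\<close> and \<open>y\<close> satisfy
  \<open>g <# (x <# H) = y <# H\<close>, then \<open>inv y \<otimes> g \<otimes> x \<in> H\<close>.
  Thus \<open>rel\<close> bounds the group component of the preimage of a compact set, once the
  cosets are represented by elements of a compact set.\<close>

theorem proper_action_coset_space:
  assumes lc: "locally_compact_space T" and cH: "closedin T H"
    and L: "subgroup L G" and cL: "closedin T L"
    and rel: "\<And>C. compactin T C \<Longrightarrow>
        \<exists>D. compactin T D \<and> {g \<in> L. \<exists>x\<in>C. \<exists>y\<in>C. inv y \<otimes> g \<otimes> x \<in> H} \<subseteq> D"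
  shows "proper_action (subtopology T L) Q (\<lambda>l C. l <# C)"
  unfolding proper_action_def
proof (intro allI impI)
  fix K assume K: "compactin (prod_topology Q Q) K"
  have LG: "L \<subseteq> carrier G" by (rule subgroup.subset[OF L])
  let ?P = "{(g, x). g \<in> topspace (subtopology T L) \<and> x \<in> topspace Q \<and> (x, g <# x) \<in> K}"
  let ?X = "prod_topology (subtopology T L) Q"
  let ?f = "\<lambda>z. (snd z, (\<lambda>(l, C). l <# C) z)"
  have "continuous_map ?X (prod_topology Q Q) ?f"
    by (intro continuous_map_pairedI continuous_map_snd continuous_map_action_coset LG)
  \<comment> \<open>Hausdorffness of the coset space is used here: the compact set \<open>K\<close>
    is closed, hence so is its preimage.\<close>
  moreover have "closedin (prod_topology Q Q) K"
    by (rule compactin_imp_closedin[OF _ K])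
      (simp add: Hausdorff_space_prod_topology Hausdorff_coset_space cH)
  ultimately have "closedin ?X {z \<in> topspace ?X. ?f z \<in> K}"
    by (rule closedin_continuous_map_preimage)
  also have "{z \<in> topspace ?X. ?f z \<in> K} = ?P"
    by auto
  finally have clP: "closedin ?X ?P" .
  have K1: "compactin Q (fst ` K)" and K2: "compactin Q (snd ` K)"
    using image_compactin[OF K] continuous_map_fst continuous_map_snd by blast+
  have surj: "proj ` topspace T = topspace Q" by (simp add: topspace_quotient_topology)
  obtain C1 where C1: "compactin T C1" "fst ` K \<subseteq> proj ` C1"
    using compact_lift_open_map[OF open_map_l_coset surj lc K1] .
  obtain C2 where C2: "compactin T C2" "snd ` K \<subseteq> proj ` C2"
    using compact_lift_open_map[OF open_map_l_coset surj lc K2] .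
  \<comment> \<open>Uniting the two lifts lets \<open>rel\<close> be stated with a single compact
    set for both representatives.\<close>
  define C where "C = C1 \<union> C2"
  have C: "compactin T C" unfolding C_def using C1 C2 by (simp add: compactin_Un)
  then have CG: "C \<subseteq> carrier G" using compactin_subset_topspace topspace_eq by blast
  obtain D where D: "compactin T D" "{g \<in> L. \<exists>x\<in>C. \<exists>y\<in>C. inv y \<otimes> g \<otimes> x \<in> H} \<subseteq> D"
    using rel[OF C] by blast
  have "compactin (subtopology T L) (D \<inter> L)"
    unfolding compactin_subtopology
    using compact_Int_closedin[OF D(1) cL] by simp
  then have "compactin ?X ((D \<inter> L) \<times> fst ` K)"
    using K1 by (simp add: compactin_Times)
  moreover have "?P \<subseteq> (D \<inter> L) \<times> fst ` K"
  proof
    fix z assume "z \<in> ?P"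
    then obtain g S where z: "z = (g, S)" "g \<in> L" "(S, g <# S) \<in> K" by auto
    have S: "S \<in> fst ` K" "g <# S \<in> snd ` K"
      using imageI[OF z(3), of fst] imageI[OF z(3), of snd] by simp_all
    obtain x where x: "x \<in> C" "S = proj x"
      using S(1) C1(2) unfolding C_def by blast
    obtain y where y: "y \<in> C" "g <# S = proj y"
      using S(2) C2(2) unfolding C_def by blast
    have G: "g \<in> carrier G" "x \<in> carrier G" "y \<in> carrier G" using z x y LG CG by auto
    then have "proj y = proj (g \<otimes> x)"
      using x y lcos_m_assoc[of H g x] subgroup.subset[OF H] by simp
    then have "inv y \<otimes> g \<otimes> x \<in> H"
      using G by (simp add: l_coset_eq_iff m_assoc)
    then show "z \<in> (D \<inter> L) \<times> fst ` K"
      using D(2) z x y S(1) by blast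
  qed
  ultimately show "compactin ?X ?P"
    using closed_compactin clP by blast
qed

end

end

section \<open>Invertible upper triangular matrices as a topological group\<close>

text \<open>Writing the inverse through the adjugate exhibits its entries as rational functions of
  the entries of \<open>A\<close>; continuity of inversion rests on this.\<close>

lemma mult_scaled_adj_mat:
  fixes A :: "'a :: field mat"
  assumes A: "A \<in> carrier_mat n n" and "det A \<noteq> 0"
  shows "A * (inverse (det A) \<cdot>\<^sub>m adj_mat A) = 1\<^sub>m n"
    and "(inverse (det A) \<cdot>\<^sub>m adj_mat A) * A = 1\<^sub>m n"
proof -
  note adj = adj_mat[OF A]
  have "inverse (det A) \<cdot>\<^sub>m (det A \<cdot>\<^sub>m 1\<^sub>m n) = 1\<^sub>m n"
    using assms(2) by (intro eq_matI) auto
  then show "A * (inverse (det A) \<cdot>\<^sub>m adj_mat A) = 1\<^sub>m n"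
    and "(inverse (det A) \<cdot>\<^sub>m adj_mat A) * A = 1\<^sub>m n"
    using adj A by (simp_all add: mult_smult_distrib[OF A adj(1)] mult_smult_assoc_mat[OF adj(1) A])
qed

lemma invertible_mat_iff_det:
  fixes A :: "'a :: field mat"
  assumes A: "A \<in> carrier_mat n n"
  shows "invertible_mat A \<longleftrightarrow> det A \<noteq> 0"
proof
  assume "invertible_mat A"
  then obtain B where AB: "A * B = 1\<^sub>m (dim_row A)" and BA: "B * A = 1\<^sub>m (dim_row B)"
    unfolding invertible_mat_def inverts_mat_def by blast
  \<comment> \<open>\<open>invertible_mat\<close> leaves the size of the inverse open; comparing
    dimensions in both equations fixes it.\<close>
  have "dim_col B = n" using arg_cong[OF AB, of dim_col] A by simp
  moreover have "dim_row B = n" using arg_cong[OF BA, of dim_col] A by simp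
  ultimately have "B \<in> carrier_mat n n" by (rule carrier_matI[rotated])
  from det_mult[OF A this] show "det A \<noteq> 0" using AB A by auto
next
  assume "det A \<noteq> 0"
  note inv = mult_scaled_adj_mat[OF A this]
  have "dim_row (adj_mat A) = n" using adj_mat(1)[OF A] by simp
  then show "invertible_mat A"
    unfolding invertible_mat_def inverts_mat_def using A inv
    by (intro conjI exI[of _ "inverse (det A) \<cdot>\<^sub>m adj_mat A"]) simp_all
qed

lemma upper_triangular_mult:
  fixes A B :: "'a :: semiring_0 mat"
  assumes A: "A \<in> carrier_mat n n" "upper_triangular A" and B: "B \<in> carrier_mat n n" "upper_triangular B"
  shows "upper_triangular (A * B)"
proof
  fix i j assume ij: "j < i" "i < dim_row (A * B)"
  have "A $$ (i, k) * B $$ (k, j) = 0" if "k < n" for k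
  proof (cases "k < i")
    case True
    then show ?thesis using A ij upper_triangularD[of A k i] by simp
  next
    case False
    then show ?thesis using B ij that upper_triangularD[of B j k] by simp
  qed
  then show "(A * B) $$ (i, j) = 0"
    using ij A B by (simp add: scalar_prod_def)
qed

text \<open>Induction on the column \<open>j\<close>: in the entry (i, j) of \<open>Y * X\<close>,
  with j < i, terms with k < j vanish by induction and terms with k > j by triangularity of
  \<open>X\<close>. What remains is \<open>Y $$ (i, j) * X $$ (j, j) = 0\<close>, and the diagonal
  of \<open>X\<close> has no zeros.\<close>

lemma upper_triangular_left_inverse:
  fixes X Y :: "'a :: idom mat"
  assumes X: "X \<in> carrier_mat n n" "upper_triangular X" "det X \<noteq> 0"
    and Y: "Y \<in> carrier_mat n n" and YX: "Y * X = 1\<^sub>m n"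
  shows "upper_triangular Y"
proof
  fix i j assume "j < i" "i < dim_row Y"
  then show "Y $$ (i, j) = 0"
  proof (induction j rule: less_induct)
    case (less j)
    then have ij: "i < n" "j < n" using Y by auto
    have "0 = (Y * X) $$ (i, j)" using less.prems ij unfolding YX by simp
    also have "\<dots> = (\<Sum>k = 0..<n. Y $$ (i, k) * X $$ (k, j))"
      using ij X Y by (simp add: scalar_prod_def)
    also have "\<dots> = (\<Sum>k = 0..<n. if k = j then Y $$ (i, j) * X $$ (j, j) else 0)"
    proof (intro sum.cong refl)
      fix k assume k: "k \<in> {0..<n}"
      show "Y $$ (i, k) * X $$ (k, j) = (if k = j then Y $$ (i, j) * X $$ (j, j) else 0)"
        using less k X upper_triangularD[of X j k] by (cases k j rule: linorder_cases) auto
    qed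
    also have "\<dots> = Y $$ (i, j) * X $$ (j, j)" using ij by simp
    finally have "Y $$ (i, j) * X $$ (j, j) = 0" by simp
    moreover have "X $$ (j, j) \<noteq> 0"
      using upper_triangular_imp_det_eq_0_iff[OF X(1,2)] X ij by (force simp: diag_mat_def)
    ultimately show ?case by simp
  qed
qed

lemma mem_B_group:
  "X \<in> carrier (B_group n) \<longleftrightarrow> X \<in> carrier_mat n n \<and> upper_triangular X \<and> det X \<noteq> 0"
  using invertible_mat_iff_det by (auto simp: B_group_def)

lemma B_group_diag_nz: "X \<in> carrier (B_group n) \<Longrightarrow> i < n \<Longrightarrow> X $$ (i, i) \<noteq> 0"
  using upper_triangular_imp_det_eq_0_iff[of X n] by (force simp: mem_B_group diag_mat_def)

lemma B_groupI:
  assumes "X \<in> carrier_mat n n" "upper_triangular X" "\<And>i. i < n \<Longrightarrow> X $$ (i, i) \<noteq> 0"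
  shows "X \<in> carrier (B_group n)"
  using assms upper_triangular_imp_det_eq_0_iff[of X n] by (auto simp: mem_B_group diag_mat_def)

lemma B_group_simps [simp]:
  "monoid.mult (B_group n) X Y = X * Y" "one (B_group n) = 1\<^sub>m n"
  by (simp_all add: B_group_def)

lemma scaled_adj_mat_B_group:
  assumes "X \<in> carrier (B_group n)"
  shows "inverse (det X) \<cdot>\<^sub>m adj_mat X \<in> carrier (B_group n)"
proof -
  let ?Y = "inverse (det X) \<cdot>\<^sub>m adj_mat X"
  have X: "X \<in> carrier_mat n n" "upper_triangular X" "det X \<noteq> 0"
    using assms by (auto simp: mem_B_group)
  have Y: "?Y \<in> carrier_mat n n" using adj_mat(1)[OF X(1)] by simp
  note YX = mult_scaled_adj_mat(2)[OF X(1,3)]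
  have "det ?Y * det X = 1" using det_mult[OF Y X(1)] YX by simp
  then have "det ?Y \<noteq> 0" by auto
  then show ?thesis
    using Y upper_triangular_left_inverse[OF X Y YX] by (simp add: mem_B_group del: det_smult)
qed

lemma group_B_group: "group (B_group n)"
proof (rule groupI)
  fix X assume X: "X \<in> carrier (B_group n)"
  then show "\<exists>Y\<in>carrier (B_group n). Y \<otimes>\<^bsub>B_group n\<^esub> X = \<one>\<^bsub>B_group n\<^esub>"
    using scaled_adj_mat_B_group[OF X] mult_scaled_adj_mat(2)[of X n]
    by (auto simp: mem_B_group[of X])
qed (auto simp: mem_B_group upper_triangular_mult det_mult)

lemma inv_B_group:
  assumes "X \<in> carrier (B_group n)"
  shows "inv\<^bsub>B_group n\<^esub> X = inverse (det X) \<cdot>\<^sub>m adj_mat X"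
  using assms scaled_adj_mat_B_group[OF assms] mult_scaled_adj_mat(2)[of X n]
  by (intro group.inv_equality[OF group_B_group]) (auto simp: mem_B_group[of X])

section \<open>Continuity of the group operations\<close>

lemma continuous_map_into_B_topology:
  assumes "\<And>z. z \<in> topspace Z \<Longrightarrow> g z \<in> carrier (B_group n)"
    and "\<And>i j. i < n \<Longrightarrow> j < n \<Longrightarrow> continuous_map Z euclideanreal (\<lambda>z. g z $$ (i, j))"
  shows "continuous_map Z (B_topology n) g"
  unfolding B_topology_def
  using assms by (intro continuous_map_pullback') (auto simp: continuous_map_componentwise o_def)

lemma continuous_map_entry:
  assumes "i < n" "j < n"
  shows "continuous_map (B_topology n) euclideanreal (\<lambda>X. X $$ (i, j))"
proof -
  have "continuous_map (B_topology n) euclideanreal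
      ((\<lambda>x. x (i, j)) \<circ> (\<lambda>X. \<lambda>p \<in> {..<n} \<times> {..<n}. X $$ p))"
    unfolding B_topology_def using assms
    by (intro continuous_map_pullback continuous_map_product_projection) auto
  then show ?thesis using assms by (simp add: o_def)
qed

lemma continuous_map_det:
  fixes g :: "'b \<Rightarrow> real mat"
  assumes g: "\<And>z. z \<in> topspace Z \<Longrightarrow> g z \<in> carrier_mat n n"
    and "\<And>i j. i < n \<Longrightarrow> j < n \<Longrightarrow> continuous_map Z euclideanreal (\<lambda>z. g z $$ (i, j))"
  shows "continuous_map Z euclideanreal (\<lambda>z. det (g z))"
proof (rule continuous_map_eq)
  show "continuous_map Z euclideanreal
      (\<lambda>z. \<Sum>p\<in>{p. p permutes {0..<n}}. signof p * (\<Prod>i = 0..<n. g z $$ (i, p i)))"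
  proof (intro continuous_map_sum continuous_map_real_mult continuous_map_prod
      continuous_map_canonical_const finite_permutations)
    fix p i assume "p \<in> {p. p permutes {0..<n}}" "i \<in> {0..<n}"
    then show "continuous_map Z euclideanreal (\<lambda>z. g z $$ (i, p i))"
      using permutes_in_image[of p "{0..<n}" i] by (intro assms(2)) auto
  qed auto
qed (simp add: det_def'[OF g])

lemma topological_group_B_group: "topological_group (B_group n) (B_topology n)"
proof (intro topological_group.intro group_B_group topological_group_axioms.intro)
  show "topspace (B_topology n) = carrier (B_group n)"
    by (rule topspace_B_topology)
  have fst: "continuous_map (prod_topology (B_topology n) (B_topology n)) euclideanreal
      (\<lambda>z. fst z $$ (i, j))" if "i < n" "j < n" for i j
    using continuous_map_compose[OF continuous_map_fst continuous_map_entry[OF that]]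
    by (simp add: o_def)
  have snd: "continuous_map (prod_topology (B_topology n) (B_topology n)) euclideanreal
      (\<lambda>z. snd z $$ (i, j))" if "i < n" "j < n" for i j
    using continuous_map_compose[OF continuous_map_snd continuous_map_entry[OF that]]
    by (simp add: o_def)
  show "continuous_map (prod_topology (B_topology n) (B_topology n)) (B_topology n)
      (\<lambda>(X, Y). X \<otimes>\<^bsub>B_group n\<^esub> Y)"
  proof (rule continuous_map_into_B_topology)
    fix z assume "z \<in> topspace (prod_topology (B_topology n) (B_topology n))"
    then show "(\<lambda>(X, Y). X \<otimes>\<^bsub>B_group n\<^esub> Y) z \<in> carrier (B_group n)"
      using group.is_monoid[OF group_B_group, THEN monoid.m_closed]
      by (auto simp: topspace_B_topology simp del: B_group_simps)
  next
    fix i j assume ij: "i < n" "j < n"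
    show "continuous_map (prod_topology (B_topology n) (B_topology n)) euclideanreal
        (\<lambda>z. (case z of (X, Y) \<Rightarrow> X \<otimes>\<^bsub>B_group n\<^esub> Y) $$ (i, j))"
    proof (rule continuous_map_eq)
      show "continuous_map (prod_topology (B_topology n) (B_topology n)) euclideanreal
          (\<lambda>z. \<Sum>k = 0..<n. fst z $$ (i, k) * snd z $$ (k, j))"
        using ij by (intro continuous_map_sum continuous_map_real_mult fst snd) auto
    qed (use ij in \<open>auto simp: topspace_B_topology mem_B_group scalar_prod_def\<close>)
  qed
  show "continuous_map (B_topology n) (B_topology n) (\<lambda>X. inv\<^bsub>B_group n\<^esub> X)"
  proof (rule continuous_map_into_B_topology)
    fix X assume "X \<in> topspace (B_topology n)"
    then show "inv\<^bsub>B_group n\<^esub> X \<in> carrier (B_group n)"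
      by (simp add: topspace_B_topology group.inv_closed[OF group_B_group])
  next
    fix i j assume ij: "i < n" "j < n"
    have det: "continuous_map (B_topology n) euclideanreal det"
      by (rule continuous_map_det[where g = "\<lambda>X. X" and n = n, unfolded eta_contract_eq])
        (auto simp: topspace_B_topology mem_B_group intro: continuous_map_entry)
    \<comment> \<open>The indices are swapped because the adjugate is the transposed cofactor
      matrix. Each entry of the smaller matrix is an entry of \<open>X\<close> at indices that skip
      row \<open>j\<close> and column \<open>i\<close>.\<close>
    have cof: "continuous_map (B_topology n) euclideanreal (\<lambda>X. det (mat_delete X j i))"
    proof (rule continuous_map_det)
      fix X assume "X \<in> topspace (B_topology n)"
      then show "mat_delete X j i \<in> carrier_mat (n - 1) (n - 1)"
        by (intro mat_delete_carrier) (simp add: topspace_B_topology mem_B_group)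
    next
      fix s t assume st: "s < n - 1" "t < n - 1"
      show "continuous_map (B_topology n) euclideanreal (\<lambda>X. mat_delete X j i $$ (s, t))"
      proof (rule continuous_map_eq)
        show "continuous_map (B_topology n) euclideanreal
            (\<lambda>X. X $$ (if s < j then s else Suc s, if t < i then t else Suc t))"
          using st by (intro continuous_map_entry) auto
      qed (use st in \<open>auto simp: topspace_B_topology mem_B_group mat_delete_def\<close>)
    qed
    show "continuous_map (B_topology n) euclideanreal (\<lambda>X. (inv\<^bsub>B_group n\<^esub> X) $$ (i, j))"
    proof (rule continuous_map_eq)
      show "continuous_map (B_topology n) euclideanreal
          (\<lambda>X. inverse (det X) * ((-1) ^ (j + i) * det (mat_delete X j i)))"
        using det cof
        by (intro continuous_map_real_mult continuous_map_real_inverse continuous_map_canonical_const)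
          (auto simp: topspace_B_topology mem_B_group)
    next
      fix X assume "X \<in> topspace (B_topology n)"
      then show "inverse (det X) * ((-1) ^ (j + i) * det (mat_delete X j i)) =
          (inv\<^bsub>B_group n\<^esub> X) $$ (i, j)"
        using ij by (simp add: topspace_B_topology inv_B_group)
          (auto simp: mem_B_group adj_mat_def cofactor_def)
    qed
  qed
qed

section \<open>Compact boxes and local compactness\<close>

definition B_box :: "nat \<Rightarrow> real \<Rightarrow> real \<Rightarrow> real mat set" where
  "B_box n r R = {X \<in> carrier (B_group n).
     (\<forall>i<n. \<forall>j<n. \<bar>X $$ (i, j)\<bar> \<le> R) \<and> (\<forall>i<n. r \<le> \<bar>X $$ (i, i)\<bar>)}"

text \<open>The bound \<open>r\<close> keeps limits invertible; with upper bounds alone they could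
  be singular. The box is the continuous image of a product of compact sets of reals: {0} below the
  diagonal, an interval with a gap around 0 on it, an interval above it.\<close>

lemma compactin_B_box:
  assumes "0 < r"
  shows "compactin (B_topology n) (B_box n r R)"
proof -
  let ?I = "{..<n} \<times> {..<n}"
  define K where "K p = cball 0 R \<inter>
    (if snd p < fst p then {0} else if fst p = snd p then {x. r \<le> \<bar>x\<bar>} else UNIV)" for p :: "nat \<times> nat"
  define g where "g x = mat n n x" for x :: "nat \<times> nat \<Rightarrow> real"
  let ?T = "product_topology (\<lambda>_. euclideanreal) ?I"
  have "compact (K p)" for p
    unfolding K_def by (intro compact_Int_closed) (auto intro!: closed_Collect_le continuous_intros)
  then have "compactin ?T (PiE ?I K)"
    by (simp add: compactin_PiE)
  then have c: "compactin (subtopology ?T (PiE ?I K)) (PiE ?I K)"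
    by simp
  have g: "g x \<in> B_box n r R" if "x \<in> PiE ?I K" for x
  proof -
    have x: "x (i, j) \<in> K (i, j)" if "i < n" "j < n" for i j
      using PiE_mem[OF \<open>x \<in> PiE ?I K\<close>, of "(i, j)"] that by simp
    have "x (i, j) = 0" if "i < n" "j < i" for i j
      using x[of i j] that by (simp add: K_def)
    then have "upper_triangular (g x)" by (auto simp: g_def)
    moreover have d: "r \<le> \<bar>x (i, i)\<bar>" if "i < n" for i
      using x[of i i] that by (simp add: K_def)
    moreover have "x (i, i) \<noteq> 0" if "i < n" for i
      using d[OF that] assms by auto
    moreover have "\<bar>x (i, j)\<bar> \<le> R" if "i < n" "j < n" for i j
      using x[OF that] by (auto simp: K_def)
    ultimately show ?thesis
      by (auto simp: B_box_def g_def intro!: B_groupI)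
  qed
  have "continuous_map (subtopology ?T (PiE ?I K)) (B_topology n) g"
  proof (rule continuous_map_into_B_topology)
    fix i j assume "i < n" "j < n"
    then show "continuous_map (subtopology ?T (PiE ?I K)) euclideanreal (\<lambda>x. g x $$ (i, j))"
      by (auto simp: g_def intro!: continuous_map_from_subtopology continuous_map_product_projection)
  qed (use g in \<open>auto simp: B_box_def\<close>)
  then have "compactin (B_topology n) (g ` PiE ?I K)"
    by (rule image_compactin[OF c])
  moreover have "g ` PiE ?I K = B_box n r R"
  proof (intro equalityI subsetI)
    fix X assume X: "X \<in> B_box n r R"
    then have Xc: "X \<in> carrier_mat n n" "upper_triangular X"
      by (auto simp: B_box_def mem_B_group)
    have "X = g (restrict (\<lambda>p. X $$ p) ?I)"
      using Xc by (intro eq_matI) (auto simp: g_def)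
    moreover have "X $$ (i, j) \<in> K (i, j)" if "i < n" "j < n" for i j
      proof -
      have "\<bar>X $$ (i, j)\<bar> \<le> R" "i = j \<Longrightarrow> r \<le> \<bar>X $$ (i, j)\<bar>" "j < i \<Longrightarrow> X $$ (i, j) = 0"
        using X that Xc by (auto simp: B_box_def)
      then show ?thesis by (auto simp: K_def)
    qed
    then have "restrict (\<lambda>p. X $$ p) ?I \<in> PiE ?I K" by auto
    ultimately show "X \<in> g ` PiE ?I K" by blast
  qed (use g in auto)
  ultimately show ?thesis by simp
qed

lemma locally_compact_B_topology: "locally_compact_space (B_topology n)"
  unfolding locally_compact_space_def
proof
  fix X assume "X \<in> topspace (B_topology n)"
  then have X: "X \<in> carrier (B_group n)" by (simp add: topspace_B_topology)
  let ?I = "{..<n} \<times> {..<n}"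
  \<comment> \<open>Adding 1 and halving make the bounds strict at \<open>X\<close>, so that they
    cut out an open neighbourhood. The inserted 0 and 1 keep \<open>Max\<close> and
    \<open>Min\<close> meaningful for n = 0.\<close>
  define R where "R = Max (insert 0 ((\<lambda>p. \<bar>X $$ p\<bar>) ` ?I)) + 1"
  define r where "r = Min (insert 1 ((\<lambda>i. \<bar>X $$ (i, i)\<bar>) ` {..<n})) / 2"
  have R: "\<bar>X $$ (i, j)\<bar> < R" if "i < n" "j < n" for i j
  proof -
    have "\<bar>X $$ (i, j)\<bar> \<le> Max (insert 0 ((\<lambda>p. \<bar>X $$ p\<bar>) ` ?I))"
      using that by (intro Max_ge) auto
    then show ?thesis by (simp add: R_def)
  qed
  have "0 < Min (insert 1 ((\<lambda>i. \<bar>X $$ (i, i)\<bar>) ` {..<n}))"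
    using B_group_diag_nz[OF X] by (subst Min_gr_iff) auto
  then have "0 < r" by (simp add: r_def)
  have r: "r < \<bar>X $$ (i, i)\<bar>" if "i < n" for i
  proof -
    have "Min (insert 1 ((\<lambda>i. \<bar>X $$ (i, i)\<bar>) ` {..<n})) \<le> \<bar>X $$ (i, i)\<bar>"
      using that by (intro Min_le) auto
    also have "Min (insert 1 ((\<lambda>i. \<bar>X $$ (i, i)\<bar>) ` {..<n})) = 2 * r"
      by (simp add: r_def)
    finally show ?thesis using \<open>0 < r\<close> by linarith
  qed
  define K where "K p = {-R<..<R} \<inter> (if fst p = snd p then {x. r < \<bar>x\<bar>} else UNIV)"
    for p :: "nat \<times> nat"
  define U where "U = (\<lambda>X. \<lambda>p \<in> ?I. X $$ p) -` (PiE ?I K) \<inter> carrier (B_group n)"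
  have "open (K p)" for p
    unfolding K_def by (intro open_Int) (auto intro!: open_Collect_less continuous_intros)
  then have "openin (product_topology (\<lambda>_. euclideanreal) ?I) (PiE ?I K)"
    by (subst openin_PiE) auto
  then have "openin (B_topology n) U"
    unfolding B_topology_def openin_pullback_topology U_def by blast
  moreover have "X \<in> U"
    using X R r by (auto simp: U_def K_def abs_less_iff minus_less_iff)
  moreover have "U \<subseteq> B_box n r R"
  proof
    fix Y assume Y: "Y \<in> U"
    have "Y $$ (i, j) \<in> K (i, j)" if "i < n" "j < n" for i j
      using Y that PiE_mem[of "\<lambda>p \<in> ?I. Y $$ p" ?I K "(i, j)"] by (auto simp: U_def)
    then show "Y \<in> B_box n r R"
      using Y by (fastforce simp: B_box_def U_def K_def)
  qed
  ultimately show "\<exists>U K. openin (B_topology n) U \<and> compactin (B_topology n) K \<and> X \<in> U \<and> U \<subseteq> K"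
    using compactin_B_box[OF \<open>0 < r\<close>] by blast
qed

lemma compactin_entries_bounded:
  assumes C: "compactin (B_topology n) C"
  obtains R where "1 \<le> R"
    "\<And>X i j. X \<in> C \<Longrightarrow> i < n \<Longrightarrow> j < n \<Longrightarrow> \<bar>X $$ (i, j)\<bar> \<le> R"
    "\<And>X i j. X \<in> C \<Longrightarrow> i < n \<Longrightarrow> j < n \<Longrightarrow> \<bar>(inv\<^bsub>B_group n\<^esub> X) $$ (i, j)\<bar> \<le> R"
proof -
  interpret topological_group "B_group n" "B_topology n" by (rule topological_group_B_group)
  have ent: "\<exists>R. \<forall>X\<in>C. \<forall>i<n. \<forall>j<n. \<bar>g X $$ (i, j)\<bar> \<le> R"
    if g: "continuous_map (B_topology n) (B_topology n) g" for g
  proof -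
    \<comment> \<open>The sum of absolute values is a single continuous function that dominates
      every entry.\<close>
    let ?h = "\<lambda>X. \<Sum>p\<in>{..<n} \<times> {..<n}. \<bar>g X $$ p\<bar>"
    have "continuous_map (B_topology n) euclideanreal ?h"
    proof (intro continuous_map_sum continuous_map_real_abs)
      fix p assume "p \<in> {..<n} \<times> {..<n}"
      then obtain i j where p: "p = (i, j)" "i < n" "j < n" by auto
      show "continuous_map (B_topology n) euclideanreal (\<lambda>X. g X $$ p)"
        using continuous_map_compose[OF g continuous_map_entry[OF p(2,3)]] p(1) by (simp add: o_def)
    qed auto
    then have "compact (?h ` C)"
      using image_compactin[OF C] by (metis compactin_euclidean_iff)
    from compact_imp_bounded[OF this] obtain R where "\<forall>x\<in>?h ` C. norm x \<le> R"
      unfolding bounded_iff by blast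
    then have R: "\<bar>?h X\<bar> \<le> R" if "X \<in> C" for X
      using that by simp
    have "\<bar>g X $$ (i, j)\<bar> \<le> R" if "X \<in> C" "i < n" "j < n" for X i j
    proof -
      have "\<bar>g X $$ (i, j)\<bar> \<le> ?h X"
        using that by (intro member_le_sum[of "(i, j)" _ "\<lambda>p. \<bar>g X $$ p\<bar>"]) auto
      also have "\<dots> \<le> R" using R[OF \<open>X \<in> C\<close>] by linarith
      finally show ?thesis .
    qed
    then show ?thesis by blast
  qed
  obtain R1 where R1: "\<forall>X\<in>C. \<forall>i<n. \<forall>j<n. \<bar>X $$ (i, j)\<bar> \<le> R1"
    using ent[of "\<lambda>X. X"] by auto
  obtain R2 where R2: "\<forall>X\<in>C. \<forall>i<n. \<forall>j<n. \<bar>(inv\<^bsub>B_group n\<^esub> X) $$ (i, j)\<bar> \<le> R2"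
    using ent[OF continuous_inv] by auto
  \<comment> \<open>The value 1 in the maximum makes powers of \<open>real n * R\<close> increase
    with the exponent when n \<ge> 1.\<close>
  show thesis
    by (rule that[of "max 1 (max R1 R2)"]) (use R1 R2 in \<open>auto simp: le_max_iff_disj\<close>)
qed

section \<open>Minors of matrix products\<close>

lemma card_index_subset:
  assumes "I \<subseteq> {..<m}"
  shows "card {i. i < m \<and> i \<in> I} = card I"
  using assms by (intro arg_cong[of _ _ card]) auto

text \<open>A repeated row makes the determinant 0. Otherwise the chosen rows are those of a genuine
  submatrix in another order, so the determinant is a minor of \<open>Y\<close> up to the sign of
  the sorting permutation.\<close>

lemma abs_det_select_rows_le:
  fixes Y :: "real mat"
  assumes Y: "Y \<in> carrier_mat m q" and f: "f \<in> {0..<q} \<rightarrow> {0..<m}" and "0 \<le> M"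
    and M: "\<And>I. I \<subseteq> {..<m} \<Longrightarrow> card I = q \<Longrightarrow> \<bar>det (submatrix Y I UNIV)\<bar> \<le> M"
  shows "\<bar>det (mat\<^sub>r q q (\<lambda>i. row Y (f i)))\<bar> \<le> M"
proof (cases "inj_on f {0..<q}")
  case False
  then obtain i j where ij: "i < q" "j < q" "i \<noteq> j" "f i = f j"
    by (auto simp: inj_on_def)
  have "det (mat\<^sub>r q q (\<lambda>i. row Y (f i))) = 0"
  proof (rule det_identical_rows[OF _ ij(3,1,2)])
    show "row (mat\<^sub>r q q (\<lambda>i. row Y (f i))) i = row (mat\<^sub>r q q (\<lambda>i. row Y (f i))) j"
      using ij by (intro eq_vecI) auto
  qed (simp add: carrier_matI)
  then show ?thesis using \<open>0 \<le> M\<close> by simp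
next
  case inj: True
  define I where "I = f ` {0..<q}"
  have I: "I \<subseteq> {..<m}" "card I = q"
    using f inj by (auto simp: I_def card_image)
  \<comment> \<open>The rank of \<open>f i\<close> within \<open>I\<close>, which
    \<open>pick I\<close> inverts; the identity outside the index range is what
    \<open>permutes\<close> demands.\<close>
  define \<sigma> where "\<sigma> i = (if i < q then card {a \<in> I. a < f i} else i)" for i
  have pick: "pick I (\<sigma> i) = f i" if "i < q" for i
    using that by (simp add: \<sigma>_def I_def pick_card_in_set)
  have "\<sigma> ` {0..<q} \<subseteq> {0..<q}"
  proof
    fix k assume "k \<in> \<sigma> ` {0..<q}"
    then obtain i where i: "i < q" "k = card {a \<in> I. a < f i}"
      by (auto simp: \<sigma>_def)
    then have "f i \<in> I - {a \<in> I. a < f i}" by (auto simp: I_def)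
    then have "{a \<in> I. a < f i} \<subset> I" by blast
    moreover have "finite I" by (simp add: I_def)
    ultimately have "card {a \<in> I. a < f i} < card I" by (rule psubset_card_mono[rotated])
    then show "k \<in> {0..<q}" using i I(2) by simp
  qed
  moreover have "inj_on \<sigma> {0..<q}"
    by (intro inj_onI) (metis atLeastLessThan_iff inj inj_onD pick)
  ultimately have "bij_betw \<sigma> {0..<q} {0..<q}"
    by (simp add: bij_betw_def endo_inj_surj)
  then have \<sigma>: "\<sigma> permutes {0..<q}"
    by (rule bij_imp_permutes) (simp add: \<sigma>_def)
  define Z where "Z = submatrix Y I UNIV"
  have dims: "card {i. i < dim_row Y \<and> i \<in> I} = q" "card {j. j < dim_col Y \<and> j \<in> UNIV} = q"
    using Y I card_index_subset[OF I(1)] by auto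
  have Z: "Z \<in> carrier_mat q q"
    unfolding Z_def using dims by (intro carrier_matI) (simp_all add: dim_submatrix)
  have "mat\<^sub>r q q (\<lambda>i. row Y (f i)) = mat q q (\<lambda>(i, j). Z $$ (\<sigma> i, j))"
  proof (rule eq_matI)
    fix i j assume "i < dim_row (mat q q (\<lambda>(i, j). Z $$ (\<sigma> i, j)))"
      "j < dim_col (mat q q (\<lambda>(i, j). Z $$ (\<sigma> i, j)))"
    then have ij: "i < q" "j < q" by simp_all
    then have "\<sigma> i < q" using permutes_in_image[OF \<sigma>, of i] by simp
    then have "Z $$ (\<sigma> i, j) = Y $$ (f i, j)"
      unfolding Z_def using ij dims by (subst submatrix_index) (auto simp: pick pick_UNIV)
    moreover have "f i < m" using f ij by auto
    ultimately show "mat\<^sub>r q q (\<lambda>i. row Y (f i)) $$ (i, j) = mat q q (\<lambda>(i, j). Z $$ (\<sigma> i, j)) $$ (i, j)"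
      using ij Y by simp
  qed simp_all
  then have "det (mat\<^sub>r q q (\<lambda>i. row Y (f i))) = signof \<sigma> * det Z"
    by (simp add: det_permute_rows[OF Z \<sigma>])
  then have "\<bar>det (mat\<^sub>r q q (\<lambda>i. row Y (f i)))\<bar> = \<bar>det Z\<bar>"
    by (simp add: abs_mult sign_def)
  also have "\<dots> \<le> M" unfolding Z_def by (rule M[OF I])
  finally show ?thesis .
qed

text \<open>Every row of \<open>P * Y\<close> is a combination of the m rows of \<open>Y\<close>.
  Multilinearity yields at most m^q terms, each a product of q entries of \<open>P\<close> times a
  determinant of selected rows of \<open>Y\<close>, hence at most a^q M in absolute value.\<close>

lemma abs_det_mult_le:
  fixes P Y :: "real mat"
  assumes P: "P \<in> carrier_mat q m" and Y: "Y \<in> carrier_mat m q" and "0 \<le> M" and "0 \<le> a"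
    and a: "\<And>i j. i < q \<Longrightarrow> j < m \<Longrightarrow> \<bar>P $$ (i, j)\<bar> \<le> a"
    and M: "\<And>I. I \<subseteq> {..<m} \<Longrightarrow> card I = q \<Longrightarrow> \<bar>det (submatrix Y I UNIV)\<bar> \<le> M"
  shows "\<bar>det (P * Y)\<bar> \<le> (real m * a) ^ q * M"
proof -
  let ?F = "{f. (\<forall>i\<in>{0..<q}. f i \<in> {0..<m}) \<and> (\<forall>i. i \<notin> {0..<q} \<longrightarrow> f i = i)}"
  \<comment> \<open>The row expansion is indexed by functions that are the identity outside {0..<q};
    restricting them makes them countable as an extensional function space.\<close>
  have "inj_on (\<lambda>f. restrict f {0..<q}) ?F"
  proof (rule inj_onI)
    fix f g assume fg: "f \<in> ?F" "g \<in> ?F" "restrict f {0..<q} = restrict g {0..<q}"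
    show "f = g"
    proof
      fix i
      have "restrict f {0..<q} i = restrict g {0..<q} i" using fg(3) by simp
      then show "f i = g i" using fg(1,2) by (cases "i < q") auto
    qed
  qed
  moreover have "(\<lambda>f. restrict f {0..<q}) ` ?F \<subseteq> {0..<q} \<rightarrow>\<^sub>E {0..<m}"
    by auto
  ultimately have "card ?F \<le> card ({0..<q} \<rightarrow>\<^sub>E {0..<m})"
    by (rule card_inj_on_le) (simp add: finite_PiE)
  then have card: "card ?F \<le> m ^ q" by (simp add: card_PiE)
  have "det (P * Y) =
      det (mat\<^sub>r q q (\<lambda>i. finsum_vec TYPE(real) q (\<lambda>k. P $$ (i, k) \<cdot>\<^sub>v row Y k) {0..<m}))"
    using mat_mul_finsum_alt[OF P Y] by simp
  also have "\<dots> = (\<Sum>f\<in>?F. det (mat\<^sub>r q q (\<lambda>i. P $$ (i, f i) \<cdot>\<^sub>v row Y (f i))))"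
    using Y by (intro det_linear_rows_sum) auto
  also have "\<dots> = (\<Sum>f\<in>?F. (\<Prod>i = 0..<q. P $$ (i, f i)) * det (mat\<^sub>r q q (\<lambda>i. row Y (f i))))"
    using Y by (intro sum.cong refl det_rows_mul) auto
  finally have "\<bar>det (P * Y)\<bar> \<le>
      (\<Sum>f\<in>?F. \<bar>(\<Prod>i = 0..<q. P $$ (i, f i)) * det (mat\<^sub>r q q (\<lambda>i. row Y (f i)))\<bar>)"
    by simp
  also have "\<dots> \<le> real (card ?F) * (a ^ q * M)"
  proof (rule sum_bounded_above)
    fix f assume f: "f \<in> ?F"
    have "(\<Prod>i = 0..<q. \<bar>P $$ (i, f i)\<bar>) \<le> (\<Prod>i = 0..<q. a)"
      using f a by (intro prod_mono) auto
    moreover have "\<bar>det (mat\<^sub>r q q (\<lambda>i. row Y (f i)))\<bar> \<le> M"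
      using f by (intro abs_det_select_rows_le[OF Y _ \<open>0 \<le> M\<close> M]) auto
    moreover have "0 \<le> (\<Prod>i = 0..<q. \<bar>P $$ (i, f i)\<bar>)"
      by (simp add: prod_nonneg)
    ultimately show "\<bar>(\<Prod>i = 0..<q. P $$ (i, f i)) * det (mat\<^sub>r q q (\<lambda>i. row Y (f i)))\<bar> \<le> a ^ q * M"
      unfolding abs_mult abs_prod by (intro mult_mono) auto
  qed
  also have "\<dots> \<le> (real m * a) ^ q * M"
  proof -
    have "real (card ?F) \<le> real m ^ q"
      using of_nat_mono[OF card, where 'a = real] by (simp only: of_nat_power)
    then have "real (card ?F) * (a ^ q * M) \<le> real m ^ q * (a ^ q * M)"
      using \<open>0 \<le> a\<close> \<open>0 \<le> M\<close> by (intro mult_right_mono) simp_all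
    then show ?thesis by (simp only: power_mult_distrib mult.assoc)
  qed
  finally show ?thesis .
qed

lemma submatrix_carrier:
  assumes "A \<in> carrier_mat m n" "I \<subseteq> {..<m}" "J \<subseteq> {..<n}"
  shows "submatrix A I J \<in> carrier_mat (card I) (card J)"
  using assms card_index_subset[of I m] card_index_subset[of J n]
  by (intro carrier_matI) (simp_all add: dim_submatrix)

lemma submatrix_transpose: "submatrix (transpose_mat A) I J = transpose_mat (submatrix A J I)"
proof (rule eq_matI)
  fix i j
  assume "i < dim_row (transpose_mat (submatrix A J I))" "j < dim_col (transpose_mat (submatrix A J I))"
  then have ij: "i < card {i. i < dim_col A \<and> i \<in> I}" "j < card {j. j < dim_row A \<and> j \<in> J}"
    by (simp_all add: dim_submatrix)
  then show "submatrix (transpose_mat A) I J $$ (i, j) = transpose_mat (submatrix A J I) $$ (i, j)"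
    by (simp add: submatrix_index dim_submatrix pick_le)
qed (simp_all add: dim_submatrix)

lemma submatrix_mult:
  fixes A :: "'a :: semiring_0 mat"
  assumes A: "A \<in> carrier_mat l m" and X: "X \<in> carrier_mat m n"
  shows "submatrix (A * X) I J = submatrix A I UNIV * submatrix X UNIV J"
proof (rule eq_matI)
  fix i j
  assume "i < dim_row (submatrix A I UNIV * submatrix X UNIV J)"
    "j < dim_col (submatrix A I UNIV * submatrix X UNIV J)"
  then have ij: "i < card {i. i < l \<and> i \<in> I}" "j < card {j. j < n \<and> j \<in> J}"
    using A X by (auto simp: dim_submatrix)
  have p: "pick I i < l" "pick J j < n" using ij pick_le by blast+
  have "submatrix (A * X) I J $$ (i, j) = (\<Sum>k = 0..<m. A $$ (pick I i, k) * X $$ (k, pick J j))"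
    using ij p A X by (subst submatrix_index) (auto simp: scalar_prod_def)
  also have "\<dots> = (submatrix A I UNIV * submatrix X UNIV J) $$ (i, j)"
    using ij A X by (auto simp: dim_submatrix scalar_prod_def submatrix_index pick_UNIV
        intro!: sum.cong)
  finally show "submatrix (A * X) I J $$ (i, j) = (submatrix A I UNIV * submatrix X UNIV J) $$ (i, j)" .
qed (use A X in \<open>auto simp: dim_submatrix\<close>)

text \<open>Left multiplication only combines rows, so the column set \<open>J\<close> stays fixed
  and \<open>M\<close> has to bound only the minors of \<open>X\<close> on these columns.\<close>

lemma minor_mult_le:
  fixes A X :: "real mat"
  assumes A: "A \<in> carrier_mat m m" and X: "X \<in> carrier_mat m m" and "0 \<le> M" and "0 \<le> a"
    and a: "\<And>i j. i < m \<Longrightarrow> j < m \<Longrightarrow> \<bar>A $$ (i, j)\<bar> \<le> a"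
    and M: "\<And>I. I \<subseteq> {..<m} \<Longrightarrow> card I = q \<Longrightarrow> \<bar>det (submatrix X I J)\<bar> \<le> M"
    and I: "I \<subseteq> {..<m}" "card I = q" and J: "J \<subseteq> {..<m}" "card J = q"
  shows "\<bar>det (submatrix (A * X) I J)\<bar> \<le> (real m * a) ^ q * M"
  unfolding submatrix_mult[OF A X]
proof (rule abs_det_mult_le[OF _ _ \<open>0 \<le> M\<close> \<open>0 \<le> a\<close>])
  have dims: "card {i. i < m \<and> i \<in> I} = q" "card {i. i < m \<and> i \<in> J} = q"
    using I J card_index_subset[of I m] card_index_subset[of J m] by simp_all
  show "submatrix A I UNIV \<in> carrier_mat q m" "submatrix X UNIV J \<in> carrier_mat m q"
    using A X dims by (auto intro!: carrier_matI simp: dim_submatrix)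
  show "\<bar>submatrix A I UNIV $$ (i, j)\<bar> \<le> a" if "i < q" "j < m" for i j
    using that A dims pick_le[of i m I] by (auto simp: submatrix_index pick_UNIV intro!: a)
  show "\<bar>det (submatrix (submatrix X UNIV J) I' UNIV)\<bar> \<le> M" if "I' \<subseteq> {..<m}" "card I' = q" for I'
    using M[OF that] submatrix_split[of X I' J] by simp
qed

section \<open>The maximum norm of compound matrices\<close>

lemma finite_elements_mat: "finite (elements_mat A)"
  by (simp add: elements_mat_def)

lemma abs_le_max_norm:
  assumes "A \<in> carrier_mat m n" "i < m" "j < n"
  shows "\<bar>A $$ (i, j)\<bar> \<le> max_norm A"
  unfolding max_norm_def using assms
  by (intro Max_ge) (auto simp: finite_elements_mat)

lemma max_norm_leI:
  assumes "A \<in> carrier_mat m n" "0 < m" "0 < n"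
    and "\<And>i j. i < m \<Longrightarrow> j < n \<Longrightarrow> \<bar>A $$ (i, j)\<bar> \<le> M"
  shows "max_norm A \<le> M"
proof -
  have "A $$ (0, 0) \<in> elements_mat A" using assms by auto
  then show ?thesis
    unfolding max_norm_def using assms by (subst Max_le_iff) (auto simp: finite_elements_mat)
qed

lemma compound_mat_carrier:
  "A \<in> carrier_mat m m \<Longrightarrow> compound_mat q A \<in> carrier_mat (m choose q) (m choose q)"
  by (intro carrier_matI) (simp_all add: compound_mat_def Let_def length_q_subsets)

lemma abs_minor_le_max_norm:
  assumes A: "A \<in> carrier_mat m m" and I: "I \<subseteq> {..<m}" "card I = q" and J: "J \<subseteq> {..<m}" "card J = q"
  shows "\<bar>det (submatrix A I J)\<bar> \<le> max_norm (compound_mat q A)"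
proof -
  have "I \<in> set ` set (q_subsets m q)" "J \<in> set ` set (q_subsets m q)"
    unfolding set_q_subsets using I J by auto
  then obtain s t where s: "s < m choose q" "I = set (q_subsets m q ! s)"
    and t: "t < m choose q" "J = set (q_subsets m q ! t)"
    by (auto simp: in_set_conv_nth length_q_subsets)
  have "compound_mat q A $$ (s, t) = det (submatrix A I J)"
    using A s t by (simp add: compound_mat_def Let_def length_q_subsets)
  then show ?thesis
    using abs_le_max_norm[OF compound_mat_carrier[OF A] s(1) t(1)] by simp
qed

text \<open>The condition \<open>q \<le> m\<close> makes the compound matrix nonempty;
  \<open>Max\<close> of the empty set would have no usable value.\<close>

lemma max_norm_compound_leI:
  assumes A: "A \<in> carrier_mat m m" and "q \<le> m"
    and M: "\<And>I J. I \<subseteq> {..<m} \<Longrightarrow> card I = q \<Longrightarrow> J \<subseteq> {..<m} \<Longrightarrow> card J = q \<Longrightarrow>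
      \<bar>det (submatrix A I J)\<bar> \<le> M"
  shows "max_norm (compound_mat q A) \<le> M"
proof (rule max_norm_leI[OF compound_mat_carrier[OF A]])
  fix s t assume st: "s < m choose q" "t < m choose q"
  have "set (q_subsets m q ! s) \<in> set ` set (q_subsets m q)"
    "set (q_subsets m q ! t) \<in> set ` set (q_subsets m q)"
    using st by (auto simp: length_q_subsets)
  then show "\<bar>compound_mat q A $$ (s, t)\<bar> \<le> M"
    unfolding set_q_subsets
    using A st M by (simp add: compound_mat_def Let_def length_q_subsets)
qed (use \<open>q \<le> m\<close> in auto)

lemma max_norm_compound_nonneg:
  assumes "A \<in> carrier_mat m m" and "q \<le> m"
  shows "0 \<le> max_norm (compound_mat q A)"
proof -
  have "{..<q} \<subseteq> {..<m}" using assms by auto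
  then show ?thesis
    using abs_minor_le_max_norm[OF assms(1), of "{..<q}" q "{..<q}"] abs_ge_zero order_trans
    by fastforce
qed

lemma max_norm_compound_mult_left:
  assumes A: "A \<in> carrier_mat m m" and X: "X \<in> carrier_mat m m" and q: "q \<le> m" and "0 \<le> a"
    and a: "\<And>i j. i < m \<Longrightarrow> j < m \<Longrightarrow> \<bar>A $$ (i, j)\<bar> \<le> a"
  shows "max_norm (compound_mat q (A * X)) \<le> (real m * a) ^ q * max_norm (compound_mat q X)"
proof (rule max_norm_compound_leI[OF _ q])
  show "A * X \<in> carrier_mat m m" using A X by simp
  fix I J assume "I \<subseteq> {..<m}" "card I = q" "J \<subseteq> {..<m}" "card J = q"
  then show "\<bar>det (submatrix (A * X) I J)\<bar> \<le> (real m * a) ^ q * max_norm (compound_mat q X)"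
    by (intro minor_mult_le[OF A X max_norm_compound_nonneg[OF X q] \<open>0 \<le> a\<close> a])
      (auto intro: abs_minor_le_max_norm[OF X])
qed

text \<open>Transposition turns right multiplication into left multiplication and merely exchanges
  the row and column sets of a minor.\<close>

lemma max_norm_compound_mult_right:
  assumes A: "A \<in> carrier_mat m m" and X: "X \<in> carrier_mat m m" and q: "q \<le> m" and "0 \<le> a"
    and a: "\<And>i j. i < m \<Longrightarrow> j < m \<Longrightarrow> \<bar>A $$ (i, j)\<bar> \<le> a"
  shows "max_norm (compound_mat q (X * A)) \<le> (real m * a) ^ q * max_norm (compound_mat q X)"
proof (rule max_norm_compound_leI[OF _ q])
  show "X * A \<in> carrier_mat m m" using A X by simp
  have T: "\<bar>det (submatrix (transpose_mat Y) I J)\<bar> = \<bar>det (submatrix Y J I)\<bar>"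
    if "Y \<in> carrier_mat m m" "I \<subseteq> {..<m}" "card I = q" "J \<subseteq> {..<m}" "card J = q"
    for Y :: "real mat" and I J
    using det_transpose[of "submatrix Y J I" q] submatrix_carrier[OF that(1,4,2)] that(3,5)
    by (simp add: submatrix_transpose)
  have tXA: "transpose_mat (X * A) = transpose_mat A * transpose_mat X"
    by (rule transpose_mult[OF X A])
  fix I J assume IJ: "I \<subseteq> {..<m}" "card I = q" "J \<subseteq> {..<m}" "card J = q"
  have "\<bar>det (submatrix (X * A) I J)\<bar> = \<bar>det (submatrix (transpose_mat A * transpose_mat X) J I)\<bar>"
    using T[of "X * A" J I] IJ A X by (simp add: tXA)
  also have "\<dots> \<le> (real m * a) ^ q * max_norm (compound_mat q X)"
    using IJ A X by (intro minor_mult_le[OF _ _ max_norm_compound_nonneg[OF X q] \<open>0 \<le> a\<close>])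
      (auto simp: T intro: abs_minor_le_max_norm[OF X] a)
  finally show "\<bar>det (submatrix (X * A) I J)\<bar> \<le> (real m * a) ^ q * max_norm (compound_mat q X)" .
qed

section \<open>Coarse invariance of \<open>\<mu>\<close>\<close>

lemma Phi_carrier: "Phi i j X \<in> carrier_mat (j - i + 1) (j - i + 1)"
  by (simp add: Phi_def)

text \<open>In a block entry of the product, summation indices before the block are killed by the
  zeros of \<open>X\<close> below its diagonal, and indices after the block by those of
  \<open>Y\<close>.\<close>

lemma Phi_mult:
  assumes X: "X \<in> carrier_mat n n" "upper_triangular X" and Y: "Y \<in> carrier_mat n n" "upper_triangular Y"
    and ij: "1 \<le> i" "i \<le> j" "j \<le> n"
  shows "Phi i j (X * Y) = Phi i j X * Phi i j Y"
proof (rule eq_matI)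
  fix s t assume "s < dim_row (Phi i j X * Phi i j Y)" "t < dim_col (Phi i j X * Phi i j Y)"
  then have st: "s < j - i + 1" "t < j - i + 1" by (simp_all add: Phi_def)
  define f where "f k = X $$ (i - 1 + s, k) * Y $$ (k, i - 1 + t)" for k
  have "Phi i j (X * Y) $$ (s, t) = sum f {0..<n}"
    using st ij X Y by (auto simp: Phi_def scalar_prod_def f_def)
  also have "\<dots> = sum f {i - 1..<i - 1 + (j - i + 1)}"
  proof (rule sum.mono_neutral_right)
    show "\<forall>k\<in>{0..<n} - {i - 1..<i - 1 + (j - i + 1)}. f k = 0"
    proof
      fix k assume k: "k \<in> {0..<n} - {i - 1..<i - 1 + (j - i + 1)}"
      show "f k = 0"
      proof (cases "k < i - 1")
        case True
        then have "X $$ (i - 1 + s, k) = 0"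
          using X st ij by (intro upper_triangularD) auto
        then show ?thesis by (simp add: f_def)
      next
        case False
        then have "Y $$ (k, i - 1 + t) = 0"
          using Y st ij k by (intro upper_triangularD) auto
        then show ?thesis by (simp add: f_def)
      qed
    qed
  qed (use ij in auto)
  also have "\<dots> = (\<Sum>k = 0..<j - i + 1. f (i - 1 + k))"
    using sum.shift_bounds_nat_ivl[of f 0 "i - 1" "j - i + 1"] by (simp add: add.commute)
  also have "\<dots> = (Phi i j X * Phi i j Y) $$ (s, t)"
    using st by (simp add: Phi_def scalar_prod_def f_def)
  finally show "Phi i j (X * Y) $$ (s, t) = (Phi i j X * Phi i j Y) $$ (s, t)" .
qed (simp_all add: Phi_def)

lemma max_norm_compound_Phi_le:
  assumes B: "A \<in> carrier (B_group n)" "X \<in> carrier (B_group n)" "B \<in> carrier (B_group n)"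
    and R: "1 \<le> R" "\<And>i j. i < n \<Longrightarrow> j < n \<Longrightarrow> \<bar>A $$ (i, j)\<bar> \<le> R"
      "\<And>i j. i < n \<Longrightarrow> j < n \<Longrightarrow> \<bar>B $$ (i, j)\<bar> \<le> R"
    and ij: "1 \<le> i" "i \<le> j" "j \<le> n" and q: "q \<le> j - i + 1"
  shows "max_norm (compound_mat q (Phi i j (A * X * B))) \<le>
    (real n * R) ^ (2 * n) * max_norm (compound_mat q (Phi i j X))"
proof -
  define m where "m = j - i + 1"
  have m: "1 \<le> m" "m \<le> n" "q \<le> m" using ij q by (auto simp: m_def)
  have "0 \<le> R" using R by simp
  have "Phi i j (A * X * B) = Phi i j A * Phi i j X * Phi i j B"
    using B ij Phi_mult[of "A * X" n B i j] Phi_mult[of A n X i j]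
      upper_triangular_mult[of A n X] mult_carrier_mat[of A n n X n]
    by (simp add: mem_B_group)
  moreover have carrier: "Phi i j Y \<in> carrier_mat m m" for Y
    using Phi_carrier by (simp add: m_def)
  moreover have entry: "\<bar>Phi i j Y $$ (s, t)\<bar> \<le> R"
    if "\<And>i j. i < n \<Longrightarrow> j < n \<Longrightarrow> \<bar>Y $$ (i, j)\<bar> \<le> R" "s < m" "t < m" for Y s t
    using that(2,3) ij that(1)[of "i - 1 + s" "i - 1 + t"] by (simp add: Phi_def m_def)
  ultimately have "max_norm (compound_mat q (Phi i j (A * X * B))) \<le>
      (real m * R) ^ q * max_norm (compound_mat q (Phi i j A * Phi i j X))"
    using max_norm_compound_mult_right[OF carrier[of B] _ m(3) \<open>0 \<le> R\<close> entry[OF R(3)],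
        of "Phi i j A * Phi i j X"] mult_carrier_mat[OF carrier carrier] by simp
  also have "max_norm (compound_mat q (Phi i j A * Phi i j X)) \<le>
      (real m * R) ^ q * max_norm (compound_mat q (Phi i j X))"
    by (rule max_norm_compound_mult_left[OF carrier carrier m(3) \<open>0 \<le> R\<close> entry[OF R(2)]])
  finally have "max_norm (compound_mat q (Phi i j (A * X * B))) \<le>
      (real m * R) ^ (2 * q) * max_norm (compound_mat q (Phi i j X))"
    using \<open>0 \<le> R\<close> by (simp add: mult_left_mono mult_2 power_add mult.assoc)
  \<comment> \<open>Each side contributes a factor \<open>(real m * R) ^ q\<close>; it is enlarged
    to a constant that does not depend on i, j and q.\<close>
  moreover have "(real m * R) ^ (2 * q) \<le> (real n * R) ^ (2 * n)"
  proof -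
    have "1 * 1 \<le> real n * R" using m R by (intro mult_mono) auto
    have "(real m * R) ^ (2 * q) \<le> (real n * R) ^ (2 * q)"
      using m \<open>0 \<le> R\<close> by (intro power_mono mult_right_mono) auto
    also have "\<dots> \<le> (real n * R) ^ (2 * n)"
      using \<open>1 * 1 \<le> real n * R\<close> m by (intro power_increasing) auto
    finally show ?thesis .
  qed
  ultimately show ?thesis
    by (blast intro: order_trans mult_right_mono max_norm_compound_nonneg[OF carrier m(3)])
qed

text \<open>Since \<open>ln 0 = 0\<close>, the case \<open>a = b = 0\<close> is covered as well.\<close>
lemma abs_ln_diff_le:
  fixes a b K :: real
  assumes "0 \<le> a" "0 \<le> b" "1 \<le> K" "a \<le> K * b" "b \<le> K * a"
  shows "\<bar>ln a - ln b\<bar> \<le> ln K"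
proof (cases "a = 0 \<or> b = 0")
  case True
  then have "a = 0" "b = 0" using assms by auto
  then show ?thesis using assms by simp
next
  case False
  then have p: "0 < a" "0 < b" "0 < K" using assms by auto
  have "ln a \<le> ln (K * b)" "ln b \<le> ln (K * a)"
    using p assms by simp_all
  then show ?thesis using p by (simp add: ln_mult)
qed

text \<open>\<open>X\<close> is recovered from \<open>A * X * B\<close> by multiplying with the
  inverses, so the one-sided norm estimate applies in both directions. For the exponent -1 the
  factors become the inverses of \<open>B\<close> and \<open>A\<close>, in this order; the bound
  \<open>R\<close> on a set closed under inversion covers this case too.\<close>

lemma euclid_dist_mu_le:
  assumes \<Lambda>: "\<Lambda> \<subseteq> Lambda1 n"
    and B: "A \<in> carrier (B_group n)" "X \<in> carrier (B_group n)" "B \<in> carrier (B_group n)"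
    and R: "1 \<le> R"
      "\<And>Y i j. Y \<in> {A, B, inv\<^bsub>B_group n\<^esub> A, inv\<^bsub>B_group n\<^esub> B} \<Longrightarrow> i < n \<Longrightarrow> j < n \<Longrightarrow> \<bar>Y $$ (i, j)\<bar> \<le> R"
  shows "euclid_dist \<Lambda> (mu n \<Lambda> X) (mu n \<Lambda> (A * X * B)) \<le> real (card \<Lambda>) * ln ((real n * R) ^ (2 * n))"
proof -
  interpret group "B_group n" by (rule group_B_group)
  let ?inv = "\<lambda>Y. inv\<^bsub>B_group n\<^esub> Y"
  let ?K = "(real n * R) ^ (2 * n)"
  have coord: "\<bar>mu n \<Lambda> X l - mu n \<Lambda> (A * X * B) l\<bar> \<le> ln ?K" if "l \<in> \<Lambda>" for l
  proof -
    obtain i j q e where l: "l = (i, j, q, e)" by (cases l)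
    with that \<Lambda> have ij: "1 \<le> i" "i \<le> j" "j \<le> n" "q \<le> j - i + 1" and e: "e = 1 \<or> e = -1"
      by (auto simp: Lambda1_def)
    let ?N = "\<lambda>Y. max_norm (compound_mat q (Phi i j Y))"
    \<comment> \<open>The index \<open>l\<close> forces n \<ge> 1, so the base of the power is at
      least 1.\<close>
    have K: "1 \<le> ?K"
    proof (rule one_le_power)
      have "1 * 1 \<le> real n * R" using ij R(1) by (intro mult_mono) auto
      then show "1 \<le> real n * R" by simp
    qed
    have nn: "0 \<le> ?N Y" for Y
      using max_norm_compound_nonneg[OF Phi_carrier ij(4)] .
    have two_sided: "\<bar>ln (?N Y) - ln (?N (P * Y * Q))\<bar> \<le> ln ?K"
      if "Y \<in> carrier (B_group n)" "P \<in> carrier (B_group n)" "Q \<in> carrier (B_group n)"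
        and PQ: "\<And>Z i j. Z \<in> {P, Q, ?inv P, ?inv Q} \<Longrightarrow> i < n \<Longrightarrow> j < n \<Longrightarrow> \<bar>Z $$ (i, j)\<bar> \<le> R"
      for Y P Q
    proof (rule abs_ln_diff_le[OF nn nn K])
      show "?N (P * Y * Q) \<le> ?K * ?N Y"
        using that ij R(1) by (intro max_norm_compound_Phi_le) auto
      have "?inv P \<otimes>\<^bsub>B_group n\<^esub> (P \<otimes>\<^bsub>B_group n\<^esub> Y \<otimes>\<^bsub>B_group n\<^esub> Q) \<otimes>\<^bsub>B_group n\<^esub> ?inv Q
          = (?inv P \<otimes>\<^bsub>B_group n\<^esub> P) \<otimes>\<^bsub>B_group n\<^esub> Y \<otimes>\<^bsub>B_group n\<^esub> (Q \<otimes>\<^bsub>B_group n\<^esub> ?inv Q)"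
        using that(1-3) by (simp only: m_assoc m_closed inv_closed)
      also have "\<dots> = Y"
        using that(1-3) by (simp only: l_inv r_inv l_one r_one)
      finally have Y: "?inv P * (P * Y * Q) * ?inv Q = Y" by simp
      have "P * Y * Q \<in> carrier (B_group n)"
        using that(1-3) m_closed by simp
      then have "?N (?inv P * (P * Y * Q) * ?inv Q) \<le> ?K * ?N (P * Y * Q)"
        using that ij R(1) by (intro max_norm_compound_Phi_le) auto
      then show "?N Y \<le> ?K * ?N (P * Y * Q)" by (simp only: Y)
    qed
    have AXB: "A * X * B \<in> carrier (B_group n)" using B m_closed by simp
    from e show ?thesis
    proof
      assume "e = 1"
      then show ?thesis
        using that B AXB two_sided[OF B(2,1,3)] R(2) by (auto simp: mu_def l)
    next
      assume e: "e = -1"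
      have "?inv (A \<otimes>\<^bsub>B_group n\<^esub> X \<otimes>\<^bsub>B_group n\<^esub> B) =
          ?inv B \<otimes>\<^bsub>B_group n\<^esub> ?inv X \<otimes>\<^bsub>B_group n\<^esub> ?inv A"
        using B by (simp only: inv_mult_group m_assoc m_closed inv_closed)
      then have inv: "?inv (A * X * B) = ?inv B * ?inv X * ?inv A" by simp
      have "\<bar>ln (?N (?inv X)) - ln (?N (?inv B * ?inv X * ?inv A))\<bar> \<le> ln ?K"
        using B R(2) by (intro two_sided) auto
      then show ?thesis
        using that B AXB by (simp add: mu_def l e int_pow_neg inv)
    qed
  qed
  \<comment> \<open>The Euclidean norm is at most the sum of the absolute coordinates, whence the
    factor \<open>card \<Lambda>\<close>.\<close>
  have "euclid_dist \<Lambda> (mu n \<Lambda> X) (mu n \<Lambda> (A * X * B)) \<le>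
      (\<Sum>l\<in>\<Lambda>. \<bar>mu n \<Lambda> X l - mu n \<Lambda> (A * X * B) l\<bar>)"
    unfolding euclid_dist_def by (rule L2_set_le_sum_abs)
  also have "\<dots> \<le> real (card \<Lambda>) * ln ?K"
    by (intro sum_bounded_above coord)
  finally show ?thesis .
qed

section \<open>Properness\<close>

lemma det_submatrix_singleton:
  assumes "A \<in> carrier_mat m n" "s < m" "t < n"
  shows "det (submatrix A {s} {t}) = A $$ (s, t)"
proof -
  have "submatrix A {s} {t} \<in> carrier_mat 1 1"
    using submatrix_carrier[of A m n "{s}" "{t}"] assms by simp
  moreover have "submatrix A {s} {t} $$ (0, 0) = A $$ (s, t)"
    using submatrix_index_card[of s A t "{s}" "{t}"] assms by (simp cong: conj_cong)
  ultimately show ?thesis by (simp add: det_single)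
qed

lemma abs_le_max_norm_compound_1:
  assumes "A \<in> carrier_mat m m" "s < m" "t < m"
  shows "\<bar>A $$ (s, t)\<bar> \<le> max_norm (compound_mat 1 A)"
  using abs_minor_le_max_norm[of A m "{s}" 1 "{t}"] det_submatrix_singleton[of A m m s t] assms by simp

lemma max_norm_compound_1_single:
  assumes "A \<in> carrier_mat 1 1"
  shows "max_norm (compound_mat 1 A) = \<bar>A $$ (0, 0)\<bar>"
proof (rule antisym)
  show "max_norm (compound_mat 1 A) \<le> \<bar>A $$ (0, 0)\<bar>"
  proof (rule max_norm_compound_leI[OF assms])
    fix I J :: "nat set"
    assume "I \<subseteq> {..<1}" "card I = 1" "J \<subseteq> {..<1}" "card J = 1"
    then have "I = {0}" "J = {0}" by (auto simp: card_1_singleton_iff)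
    then show "\<bar>det (submatrix A I J)\<bar> \<le> \<bar>A $$ (0, 0)\<bar>"
      using det_submatrix_singleton[OF assms] by simp
  qed simp
qed (use abs_le_max_norm_compound_1[OF assms] in simp)

lemma mu_bounded_imp_B_box:
  assumes n: "n \<ge> 1" and \<Lambda>: "Lambda0 n \<subseteq> \<Lambda>" and X: "X \<in> carrier (B_group n)"
    and M: "\<And>l. l \<in> \<Lambda> \<Longrightarrow> \<bar>mu n \<Lambda> X l\<bar> \<le> M"
  shows "X \<in> B_box n (exp (- M)) (exp M)"
proof -
  interpret group "B_group n" by (rule group_B_group)
  have Xc: "X \<in> carrier_mat n n" using X by (simp add: mem_B_group)
  have diag: "exp (- M) \<le> \<bar>X $$ (i, i)\<bar>" if "i < n" for i
  proof -
    \<comment> \<open>The successor translates the matrix index, counted from 0, into the index of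
      \<Lambda>, counted from 1.\<close>
    have "(Suc i, Suc i, 1, 1) \<in> Lambda0 n" using that by (auto simp: Lambda0_def)
    then have l: "(Suc i, Suc i, 1, 1) \<in> \<Lambda>" using \<Lambda> by blast
    have "max_norm (compound_mat 1 (Phi (Suc i) (Suc i) X)) = \<bar>X $$ (i, i)\<bar>"
      using Phi_carrier[of "Suc i" "Suc i" X] by (subst max_norm_compound_1_single) (auto simp: Phi_def)
    then have "\<bar>ln \<bar>X $$ (i, i)\<bar>\<bar> \<le> M"
      using M[OF l] l X by (simp add: mu_def)
    then have "- M \<le> ln \<bar>X $$ (i, i)\<bar>" by linarith
    then show ?thesis using B_group_diag_nz[OF X that] by (simp add: ln_ge_iff)
  qed
  moreover have "\<bar>X $$ (i, j)\<bar> \<le> exp M" if ij: "i < n" "j < n" for i j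
  proof -
    have "(1, n, 1, 1) \<in> Lambda0 n" using n by (auto simp: Lambda0_def)
    then have l: "(1, n, 1, 1) \<in> \<Lambda>" using \<Lambda> by blast
    have "Phi 1 n X = X" using Xc n by (intro eq_matI) (auto simp: Phi_def)
    then have "\<bar>ln (max_norm (compound_mat 1 X))\<bar> \<le> M"
      using M[OF l] l X by (simp add: mu_def)
    \<comment> \<open>A nonzero diagonal entry makes the norm positive, so \<open>exp\<close> undoes
      \<open>ln\<close>.\<close>
    moreover have "0 < max_norm (compound_mat 1 X)"
      using abs_le_max_norm_compound_1[OF Xc, of 0 0] B_group_diag_nz[OF X, of 0] n by simp
    ultimately have "max_norm (compound_mat 1 X) \<le> exp M"
      by (metis abs_le_D1 exp_le_cancel_iff exp_ln)
    then show ?thesis using abs_le_max_norm_compound_1[OF Xc ij] by linarith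
  qed
  ultimately show ?thesis using X by (simp add: B_box_def)
qed

lemma euclid_bounded_coordinates:
  assumes "finite \<Lambda>" "euclid_bounded \<Lambda> A"
  obtains M where "\<And>x l. x \<in> A \<Longrightarrow> l \<in> \<Lambda> \<Longrightarrow> \<bar>x l\<bar> \<le> M"
proof -
  interpret Metric_space "extensional \<Lambda>" "euclid_dist \<Lambda>"
    by (rule Metric_space_euclid[OF assms(1)])
  from assms(2) obtain c B where cB: "A \<subseteq> mcball c B"
    unfolding euclid_bounded_def mbounded_def by blast
  \<comment> \<open>The bounding ball has an arbitrary centre \<open>c\<close>; the sum bounds all
    coordinates of the centre at once.\<close>
  have "\<bar>x l\<bar> \<le> B + (\<Sum>l\<in>\<Lambda>. \<bar>c l\<bar>)" if x: "x \<in> A" and l: "l \<in> \<Lambda>" for x l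
  proof -
    have "\<bar>x l - c l\<bar> \<le> L2_set (\<lambda>l. \<bar>x l - c l\<bar>) \<Lambda>"
      by (rule member_le_L2_set[OF assms(1) l])
    also have "\<dots> = euclid_dist \<Lambda> c x"
      by (simp add: euclid_dist_def L2_set_def power2_commute)
    also have "\<dots> \<le> B" using cB x by auto
    finally have "\<bar>x l - c l\<bar> \<le> B" .
    moreover have "\<bar>c l\<bar> \<le> (\<Sum>l\<in>\<Lambda>. \<bar>c l\<bar>)"
      using assms(1) l by (intro member_le_sum) auto
    ultimately show ?thesis by linarith
  qed
  then show thesis by (rule that)
qed

theorem theorem1:
  fixes n :: nat and \<Lambda> :: "(nat \<times> nat \<times> nat \<times> int) set" and L H :: "real mat set"
  assumes "n \<ge> 1"
    and "\<Lambda> \<subseteq> Lambda1 n" and "Lambda0 n \<subseteq> \<Lambda>"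
    and "subgroup L (B_group n)" and "closedin (B_topology n) L"
    and "subgroup H (B_group n)" and "closedin (B_topology n) H"
    and "\<And>R. R \<ge> 0 \<Longrightarrow>
           euclid_bounded \<Lambda> (mu n \<Lambda> ` L \<inter> closed_nbhd \<Lambda> R (mu n \<Lambda> ` H))"
  shows "proper_action (subtopology (B_topology n) L) (coset_topology n H)
           (\<lambda>l C. l_coset (B_group n) l C)"
proof -
  interpret topological_group "B_group n" "B_topology n" by (rule topological_group_B_group)
  have "finite \<Lambda>" using assms(2) finite_Lambda1 by (rule finite_subset)
  have "\<exists>D. compactin (B_topology n) D \<and>
      {g \<in> L. \<exists>x\<in>C. \<exists>y\<in>C. inv\<^bsub>B_group n\<^esub> y \<otimes>\<^bsub>B_group n\<^esub> g \<otimes>\<^bsub>B_group n\<^esub> x \<in> H} \<subseteq> D"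
    if C: "compactin (B_topology n) C" for C
  proof -
    obtain R where R: "1 \<le> R"
      "\<And>X i j. X \<in> C \<Longrightarrow> i < n \<Longrightarrow> j < n \<Longrightarrow> \<bar>X $$ (i, j)\<bar> \<le> R"
      "\<And>X i j. X \<in> C \<Longrightarrow> i < n \<Longrightarrow> j < n \<Longrightarrow> \<bar>(inv\<^bsub>B_group n\<^esub> X) $$ (i, j)\<bar> \<le> R"
      using compactin_entries_bounded[OF C] by blast
    have CB: "C \<subseteq> carrier (B_group n)"
      using compactin_subset_topspace[OF C] topspace_eq by simp
    \<comment> \<open>This is the largest displacement of \<mu> under the two-sided multiplications
      below; the maximum with 0 yields the side condition of the boundedness hypothesis.\<close>
    define r where "r = max 0 (real (card \<Lambda>) * ln ((real n * R) ^ (2 * n)))"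
    obtain M where M: "\<And>x l. x \<in> mu n \<Lambda> ` L \<inter> closed_nbhd \<Lambda> r (mu n \<Lambda> ` H) \<Longrightarrow> l \<in> \<Lambda> \<Longrightarrow> \<bar>x l\<bar> \<le> M"
      using euclid_bounded_coordinates[OF \<open>finite \<Lambda>\<close> assms(8)] by (metis max.cobounded1 r_def)
    have "g \<in> B_box n (exp (- M)) (exp M)"
      if g: "g \<in> L" and xy: "x \<in> C" "y \<in> C" and h: "inv\<^bsub>B_group n\<^esub> y * g * x \<in> H" for g x y
    proof -
      have G: "g \<in> carrier (B_group n)" "x \<in> carrier (B_group n)" "y \<in> carrier (B_group n)"
        using g xy CB subgroup.subset[OF assms(4)] by auto
      \<comment> \<open>The element \<open>inv y * g * x\<close> of \<open>H\<close> is the witness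
        that \<mu>(g) lies close to \<mu>(H).\<close>
      have "euclid_dist \<Lambda> (mu n \<Lambda> g) (mu n \<Lambda> (inv\<^bsub>B_group n\<^esub> y * g * x)) \<le> r"
        unfolding r_def using G R xy
        by (intro max.coboundedI2 euclid_dist_mu_le[OF assms(2)]) auto
      then have "mu n \<Lambda> g \<in> closed_nbhd \<Lambda> r (mu n \<Lambda> ` H)"
        using h by (auto simp: closed_nbhd_def mu_def)
      then show ?thesis
        using g M by (intro mu_bounded_imp_B_box[OF assms(1,3) G(1)]) auto
    qed
    then have "{g \<in> L. \<exists>x\<in>C. \<exists>y\<in>C. inv\<^bsub>B_group n\<^esub> y * g * x \<in> H} \<subseteq> B_box n (exp (- M)) (exp M)"
      by blast
    then show ?thesis using compactin_B_box[of "exp (- M)" n "exp M"] by auto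
  qed
  then show ?thesis
    unfolding coset_topology_def
    using assms(4-7) by (intro proper_action_coset_space locally_compact_B_topology) auto
qed

end
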